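(* Let $\alpha\in(0,1)$, $\tau>0$, $a,b\in\mathbb{R}$ with $a\le b<-a$, and let $f:\mathbb{R}^2\to\mathbb{R}$ be locally Lipschitz continuous and satisfy (H1) $f(0,0)=0$, and (H2) $\lim_{\varrho\to0}\ell_f(\varrho)=0$, where $$\ell_f(\varrho)=\sup\Big\{\frac{|f(x,y)-f(\hat x,\hat y)|}{\max\{|x-\hat x|,|y-\hat y|\}}:\ x,y,\hat x,\hat y\in[-\varrho,\varrho],\ (x,y)\ne(\hat x,\hat y)\Big\}.$$ Then the trivial solution of $$ {}^{C}D^\alpha_{0+}x(t)=a\,x(t)+b\,x(t-\tau)+f\big(x(t),x(t-\tau)\big),\qquad t>0,\qquad x(t)=\phi(t),\ t\in[-\tau,0],$$ is asymptotically stable.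
   Context: The Caputo derivative of a continuous $x$ is ${}^{C}D^\alpha_{0+}x(t)=\frac{d}{dt}\frac{1}{\Gamma(1-\alpha)}\int_0^t(t-s)^{-\alpha}(x(s)-x(0))\,ds$ for almost all $t$. For each continuous $\phi:[-\tau,0]\to\mathbb{R}$ the problem has a unique continuous solution $\varphi(\cdot,\phi)$ on a maximal interval $[-\tau,t_{\max}(\phi))$; since $f(0,0)=0$, $\varphi(\cdot,0)\equiv0$ is a solution (the trivial solution). With $\|\phi\|_\infty=\sup_{t\in[-\tau,0]}|\phi(t)|$: the trivial solution is stable if for every $\varepsilon>0$ there is $\delta>0$ such that every continuous $\phi$ with $\|\phi\|_\infty\le\delta$ has $t_{\max}(\phi)=\infty$ and $|\varphi(t,\phi)|\le\varepsilon$ for all $t\ge0$; it is attractive if there is $\delta>0$ such that every continuous $\phi$ with $\|\phi\|_\infty\le\delta$ has $t_{\max}(\phi)=\infty$ and $\lim_{t\to\infty}\varphi(t,\phi)=0$; it is asymptotically stable if it is stable and attractive. *)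

theory Defs
  imports "HOL-Analysis.Analysis"
begin

text \<open>Local Lipschitz continuity of f : R^2 -> R (Euclidean norm on R^2; all norms equivalent).\<close>
definition loc_lipschitz2 :: "(real \<Rightarrow> real \<Rightarrow> real) \<Rightarrow> bool" where
  "loc_lipschitz2 f \<longleftrightarrow>
     (\<forall>z::real\<times>real. \<exists>e>0. \<exists>L. L-lipschitz_on (cball z e) (\<lambda>(x, y). f x y))"

definition lip_const :: "(real \<Rightarrow> real \<Rightarrow> real) \<Rightarrow> real \<Rightarrow> real" where
  "lip_const f \<rho> = Sup {\<bar>f x y - f x' y'\<bar> / max \<bar>x - x'\<bar> \<bar>y - y'\<bar> | x y x' y'.
       x \<in> {-\<rho>..\<rho>} \<and> y \<in> {-\<rho>..\<rho>} \<and> x' \<in> {-\<rho>..\<rho>} \<and> y' \<in> {-\<rho>..\<rho>} \<and> (x, y) \<noteq> (x', y')}"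

text \<open>The function whose derivative is the Caputo derivative:
  (1/Gamma(1-alpha)) int_0^t (t-s)^(-alpha) (x(s) - x(0)) ds.\<close>
definition caputo_prim :: "real \<Rightarrow> (real \<Rightarrow> real) \<Rightarrow> real \<Rightarrow> real" where
  "caputo_prim \<alpha> x t = integral {0..t} (\<lambda>s. (t - s) powr (-\<alpha>) * (x s - x 0)) / Gamma (1 - \<alpha>)"

text \<open>x is a solution on [-tau, T) of
  ^C D^alpha x(t) = a x(t) + b x(t-tau) + f(x(t), x(t-tau)), x = phi on [-tau,0]:
  x is continuous and caputo_prim alpha x is the primitive of the right-hand side
  (hence absolutely continuous with derivative = RHS for almost all t).\<close>
definition is_solution ::
  "real \<Rightarrow> real \<Rightarrow> real \<Rightarrow> real \<Rightarrow> (real \<Rightarrow> real \<Rightarrow> real) \<Rightarrow> (real \<Rightarrow> real) \<Rightarrow> real \<Rightarrow> (real \<Rightarrow> real) \<Rightarrow> bool"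
  where
  "is_solution \<alpha> \<tau> a b f \<phi> T x \<longleftrightarrow>
     continuous_on {-\<tau>..<T} x \<and>
     (\<forall>t\<in>{-\<tau>..0}. x t = \<phi> t) \<and>
     (\<forall>t\<in>{0..<T}. caputo_prim \<alpha> x t =
         integral {0..t} (\<lambda>s. a * x s + b * x (s - \<tau>) + f (x s) (x (s - \<tau>))))"

definition is_global_solution ::
  "real \<Rightarrow> real \<Rightarrow> real \<Rightarrow> real \<Rightarrow> (real \<Rightarrow> real \<Rightarrow> real) \<Rightarrow> (real \<Rightarrow> real) \<Rightarrow> (real \<Rightarrow> real) \<Rightarrow> bool"
  where
  "is_global_solution \<alpha> \<tau> a b f \<phi> x \<longleftrightarrow> (\<forall>T>0. is_solution \<alpha> \<tau> a b f \<phi> T x)"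

definition small_init :: "real \<Rightarrow> real \<Rightarrow> (real \<Rightarrow> real) \<Rightarrow> bool" where
  "small_init \<tau> \<delta> \<phi> \<longleftrightarrow> continuous_on {-\<tau>..0} \<phi> \<and> (\<forall>t\<in>{-\<tau>..0}. \<bar>\<phi> t\<bar> \<le> \<delta>)"

definition trivial_stable ::
  "real \<Rightarrow> real \<Rightarrow> real \<Rightarrow> real \<Rightarrow> (real \<Rightarrow> real \<Rightarrow> real) \<Rightarrow> bool" where
  "trivial_stable \<alpha> \<tau> a b f \<longleftrightarrow>
     (\<forall>\<epsilon>>0. \<exists>\<delta>>0. \<forall>\<phi>. small_init \<tau> \<delta> \<phi> \<longrightarrow>
        (\<exists>x. is_global_solution \<alpha> \<tau> a b f \<phi> x) \<and>
        (\<forall>x. is_global_solution \<alpha> \<tau> a b f \<phi> x \<longrightarrow> (\<forall>t\<ge>0. \<bar>x t\<bar> \<le> \<epsilon>)))"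

definition trivial_attractive ::
  "real \<Rightarrow> real \<Rightarrow> real \<Rightarrow> real \<Rightarrow> (real \<Rightarrow> real \<Rightarrow> real) \<Rightarrow> bool" where
  "trivial_attractive \<alpha> \<tau> a b f \<longleftrightarrow>
     (\<exists>\<delta>>0. \<forall>\<phi>. small_init \<tau> \<delta> \<phi> \<longrightarrow>
        (\<exists>x. is_global_solution \<alpha> \<tau> a b f \<phi> x) \<and>
        (\<forall>x. is_global_solution \<alpha> \<tau> a b f \<phi> x \<longrightarrow> (x \<longlongrightarrow> 0) at_top))"

definition trivial_asymp_stable ::
  "real \<Rightarrow> real \<Rightarrow> real \<Rightarrow> real \<Rightarrow> (real \<Rightarrow> real \<Rightarrow> real) \<Rightarrow> bool" where
  "trivial_asymp_stable \<alpha> \<tau> a b f \<longleftrightarrow>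
     trivial_stable \<alpha> \<tau> a b f \<and> trivial_attractive \<alpha> \<tau> a b f"

end

theory Submission
  imports Defs
begin

text \<open>
  With \<open>\<mu> = -2a\<close>, let \<open>K(t) = \<mu> t\<^sup>\<alpha>\<^sup>-\<^sup>1 E\<^sub>\<alpha>\<^sub>,\<^sub>\<alpha>(-\<mu> t\<^sup>\<alpha>)\<close> be the resolvent of the Riemann-Liouville kernel
  \<open>t\<^sup>\<alpha>\<^sup>-\<^sup>1 / \<Gamma>(\<alpha>)\<close>. Log-convexity of the latter makes \<open>K\<close> strictly positive, and its total mass is \<open>1\<close>.
  Writing \<open>a x = (\<mu> + a) x - \<mu> x\<close> with \<open>\<mu> + a = -a\<close>, the variation of constants formula becomes
  \<open>x(t) = x(0) (1 - \<integral>\<^sub>0\<^sup>t K) + (1/\<mu>) K \<star> (-a x + b x(\<cdot> - \<tau>) + f)\<close>, whose linear part is convolution with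
  \<open>K(t)/2 - (b/2a) K(t - \<tau>)\<close>. Because \<open>-1 \<le> -b/a < 1\<close> and the two summands overlap on \<open>t > \<tau>\<close>, the
  \<open>L\<^sup>1\<close> norm of this kernel is strictly below \<open>1\<close>, even in the borderline case \<open>b = a\<close>.
  A perturbation with small Lipschitz constant preserves the contraction; it yields global existence,
  the a priori bound that gives stability, and decay by a limit superior argument.
\<close>

section \<open>Convolution on the half-line\<close>

text \<open>Splitting off \<open>\<mu> x\<close> with a general \<open>\<mu> \<ge> -a\<close> leaves
  the linear kernel \<open>((\<mu> + a) K(t) + b K(t - \<tau>)) / \<mu>\<close>. Bounding its two
  summands separately gives \<open>1 - (\<bar>a\<bar> - \<bar>b\<bar>) / \<mu>\<close>, which is
  exactly 1 at \<open>b = a\<close> whatever \<open>\<mu>\<close> is, so strictness there must come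
  from cancellation between the summands. At \<open>\<mu> = -a\<close> the undelayed summand is
  absent and nothing cancels; at \<open>b = a\<close> the choice \<open>\<mu> = -2a\<close> gives
  both summands the same weight. At \<open>b = -a\<close> the signs agree, and indeed every constant
  solves the linear equation. Memory fades only algebraically, so estimates are made in the sup norm
  over the whole half-line and are expressed by masses. Let \<open>V t\<close> be the mass of
  \<open>K\<close> on \<open>[0, t]\<close>. An initial value \<open>c\<close> enters as
  \<open>c (1 - V t)\<close>, and a history bounded by \<open>\<delta>\<close> enters with at most
  \<open>\<delta> (V t - V (t - \<tau>))\<close>: both stay of order \<open>\<delta>\<close>, for
  stability, and both vanish as \<open>V\<close> tends to 1, for attractivity.\<close>

definition causal_conv :: "(real \<Rightarrow> real) \<Rightarrow> (real \<Rightarrow> real) \<Rightarrow> real \<Rightarrow> real" (infixl "\<star>" 70)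
  where "f \<star> g = (\<lambda>t. LINT s:{0..t}|lborel. f (t - s) * g s)"

text \<open>Integrability, not boundedness, up to the endpoint 0: the kernels of interest are
  singular there. Negative arguments are unconstrained, so lemmas that shift a kernel assume
  separately that it vanishes on \<open>t \<le> 0\<close>.\<close>

definition loc_int :: "(real \<Rightarrow> real) \<Rightarrow> bool"
  where "loc_int f \<longleftrightarrow> (\<forall>T. set_integrable lborel {0..T} f)"

lemma loc_intD: "loc_int f \<Longrightarrow> set_integrable lborel {0..T} f"
  by (simp add: loc_int_def)

lemma causal_conv_cong:
  assumes "\<And>s. 0 \<le> s \<Longrightarrow> s \<le> t \<Longrightarrow> f s = f' s" "\<And>s. 0 \<le> s \<Longrightarrow> s \<le> t \<Longrightarrow> g s = g' s"
  shows "(f \<star> g) t = (f' \<star> g') t"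
  unfolding causal_conv_def by (rule set_lebesgue_integral_cong) (auto simp: assms)

lemma causal_conv_nonpos: "t \<le> 0 \<Longrightarrow> (f \<star> g) t = 0"
proof -
  assume "t \<le> 0"
  then have "AE s in lborel. indicator {0..t} s *\<^sub>R (f (t - s) * g s) = 0"
    by (intro AE_I[where N="{0}"]) (auto simp: indicator_def)
  then show ?thesis
    unfolding causal_conv_def set_lebesgue_integral_def by (rule integral_eq_zero_AE)
qed

text \<open>The affine substitution \<open>s \<mapsto> t - s\<close> also carries over the default
  value 0 of a non-integrable integrand, so the identity holds for arbitrary functions.\<close>

lemma causal_conv_commute: "f \<star> g = g \<star> f"
proof
  fix t
  have "(f \<star> g) t = (LINT s|lborel. indicator {0..t} (t + (-1) * s) *\<^sub>R (f (t - (t + (-1) * s)) * g (t + (-1) * s)))"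
    unfolding causal_conv_def set_lebesgue_integral_def
    by (subst lborel_integral_real_affine[where c="-1" and t=t]) auto
  also have "\<dots> = (g \<star> f) t"
    unfolding causal_conv_def set_lebesgue_integral_def
    by (rule Bochner_Integration.integral_cong) (auto simp: indicator_def)
  finally show "(f \<star> g) t = (g \<star> f) t" .
qed

lemma continuous_bounded_Icc:
  fixes w :: "real \<Rightarrow> real"
  assumes "continuous_on {0..} w"
  obtains C where "C \<ge> 0" "\<And>s. 0 \<le> s \<Longrightarrow> s \<le> T \<Longrightarrow> \<bar>w s\<bar> \<le> C"
proof -
  have "bounded (w ` {0..T})"
    by (intro compact_imp_bounded compact_continuous_image continuous_on_subset[OF assms]) auto
  then obtain C where "\<forall>s\<in>{0..T}. \<bar>w s\<bar> \<le> C"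
    unfolding bounded_iff by auto
  then show ?thesis
    by (intro that[of "max C 0"]) (auto simp: le_max_iff_disj)
qed

lemma loc_int_reflect:
  assumes "loc_int f"
  shows "set_integrable lborel {0..t} (\<lambda>s. f (t - s))"
proof -
  have "integrable lborel (\<lambda>s. indicator {0..t} (t + (-1) * s) *\<^sub>R f (t + (-1) * s))"
    using loc_intD[OF assms, of t] unfolding set_integrable_def
    by (subst lborel_integrable_real_affine_iff) auto
  moreover have "(\<lambda>s. indicator {0..t} (t + (-1) * s) *\<^sub>R f (t + (-1) * s)) = (\<lambda>s. indicator {0..t} s *\<^sub>R f (t - s))"
    by (auto simp: indicator_def)
  ultimately show ?thesis
    unfolding set_integrable_def by simp
qed

lemma set_integrable_mult_bounded:
  fixes f w :: "real \<Rightarrow> real"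
  assumes f: "set_integrable lborel A f" and w: "set_borel_measurable lborel A w"
    and b: "\<And>s. s \<in> A \<Longrightarrow> \<bar>w s\<bar> \<le> C"
  shows "set_integrable lborel A (\<lambda>s. f s * w s)"
  unfolding set_integrable_def
proof (rule Bochner_Integration.integrable_bound)
  show "integrable lborel (\<lambda>s. C * (indicator A s *\<^sub>R f s))"
    using f unfolding set_integrable_def by simp
  have "(\<lambda>s. indicator A s *\<^sub>R (f s * w s)) = (\<lambda>s. (indicator A s *\<^sub>R f s) * (indicator A s *\<^sub>R w s))"
    by (auto simp: indicator_def)
  then show "(\<lambda>s. indicator A s *\<^sub>R (f s * w s)) \<in> borel_measurable lborel"
    using f w unfolding set_integrable_def set_borel_measurable_def by simp
  show "AE s in lborel. norm (indicator A s *\<^sub>R (f s * w s)) \<le> norm (C * (indicator A s *\<^sub>R f s))"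
  proof (rule AE_I2)
    fix s
    show "norm (indicator A s *\<^sub>R (f s * w s)) \<le> norm (C * (indicator A s *\<^sub>R f s))"
    proof (cases "s \<in> A")
      case True
      then have "\<bar>w s\<bar> * \<bar>f s\<bar> \<le> \<bar>C\<bar> * \<bar>f s\<bar>"
        using b[of s] by (intro mult_right_mono) auto
      then show ?thesis using True by (simp add: abs_mult mult.commute)
    qed simp
  qed
qed

lemma continuous_set_borel_measurable:
  fixes w :: "real \<Rightarrow> real"
  assumes "continuous_on {0..} w"
  shows "set_borel_measurable lborel {0..T} w"
proof -
  have "(\<lambda>s. indicator {0..T} s *\<^sub>R w s) \<in> borel_measurable borel"
    by (intro borel_measurable_continuous_on_indicator continuous_on_subset[OF assms]) auto
  then show ?thesis
    by (simp add: set_borel_measurable_def)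
qed

lemma causal_conv_integrable:
  assumes "loc_int f" "continuous_on {0..} w"
  shows "set_integrable lborel {0..t} (\<lambda>s. f (t - s) * w s)"
proof -
  obtain C where "C \<ge> 0" "\<And>s. 0 \<le> s \<Longrightarrow> s \<le> t \<Longrightarrow> \<bar>w s\<bar> \<le> C"
    using continuous_bounded_Icc[OF assms(2), of t] by blast
  then show ?thesis
    by (intro set_integrable_mult_bounded[where C=C] loc_int_reflect assms continuous_set_borel_measurable) auto
qed

lemma causal_conv_add:
  assumes "loc_int f" "continuous_on {0..} u" "continuous_on {0..} w"
  shows "(f \<star> (\<lambda>s. u s + w s)) t = (f \<star> u) t + (f \<star> w) t"
  unfolding causal_conv_def distrib_left
  by (intro set_integral_add(2) causal_conv_integrable assms)

lemma causal_conv_cmult: "(f \<star> (\<lambda>s. c * w s)) t = c * (f \<star> w) t"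
  unfolding causal_conv_def
  by (subst set_integral_mult_right[symmetric]) (simp add: algebra_simps)

lemma causal_conv_diff:
  assumes "loc_int f" "continuous_on {0..} u" "continuous_on {0..} w"
  shows "(f \<star> (\<lambda>s. u s - w s)) t = (f \<star> u) t - (f \<star> w) t"
  using causal_conv_add[OF assms(1,2), of "\<lambda>s. (-1) * w s" t] causal_conv_cmult[of f "-1" w t]
    assms(3) by (simp add: continuous_on_minus)

lemma causal_conv_add_left:
  assumes "loc_int f" "loc_int g" "continuous_on {0..} w"
  shows "((\<lambda>s. f s + c * g s) \<star> w) t = (f \<star> w) t + c * (g \<star> w) t"
proof -
  have "((\<lambda>s. f s + c * g s) \<star> w) t = (LINT s:{0..t}|lborel. f (t - s) * w s + c * (g (t - s) * w s))"
    unfolding causal_conv_def by (simp add: algebra_simps)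
  also have "\<dots> = (f \<star> w) t + c * (g \<star> w) t"
    unfolding causal_conv_def
    using causal_conv_integrable[OF assms(1,3), of t] causal_conv_integrable[OF assms(2,3), of t]
    by (subst set_integral_add(2)) auto
  finally show ?thesis .
qed

lemma causal_conv_mono:
  assumes "loc_int f" "\<And>s. 0 \<le> s \<Longrightarrow> s \<le> t \<Longrightarrow> f s \<ge> 0"
    and "continuous_on {0..} u" "continuous_on {0..} w" "\<And>s. 0 \<le> s \<Longrightarrow> s \<le> t \<Longrightarrow> u s \<le> w s"
  shows "(f \<star> u) t \<le> (f \<star> w) t"
  unfolding causal_conv_def
  by (intro set_integral_mono causal_conv_integrable assms) (auto intro!: mult_left_mono assms)

text \<open>The form in which kernels are measured throughout: convolving
  \<open>\<bar>f\<bar>\<close> with the constant 1 is the truncated \<open>L^1\<close> norm of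
  \<open>f\<close> on \<open>[0, t]\<close>.\<close>

lemma abs_causal_conv_le:
  assumes "loc_int f" "continuous_on {0..} w" "\<And>s. 0 \<le> s \<Longrightarrow> s \<le> t \<Longrightarrow> \<bar>w s\<bar> \<le> C"
  shows "\<bar>(f \<star> w) t\<bar> \<le> ((\<lambda>s. \<bar>f s\<bar>) \<star> (\<lambda>_. 1)) t * C"
proof -
  have "\<bar>(f \<star> w) t\<bar> \<le> (LINT s:{0..t}|lborel. \<bar>f (t - s) * w s\<bar>)"
    using set_integral_norm_bound[OF causal_conv_integrable[OF assms(1,2)], of t]
    by (simp add: causal_conv_def)
  also have "\<dots> \<le> (LINT s:{0..t}|lborel. C * \<bar>f (t - s)\<bar>)"
  proof (rule set_integral_mono)
    show "set_integrable lborel {0..t} (\<lambda>s. \<bar>f (t - s) * w s\<bar>)"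
      using set_integrable_norm[OF causal_conv_integrable[OF assms(1,2), of t]] by simp
    show "set_integrable lborel {0..t} (\<lambda>s. C * \<bar>f (t - s)\<bar>)"
      using set_integrable_norm[OF loc_int_reflect[OF assms(1), of t]] by simp
    fix s assume "s \<in> {0..t}"
    then have "\<bar>w s\<bar> \<le> C" using assms(3) by auto
    then show "\<bar>f (t - s) * w s\<bar> \<le> C * \<bar>f (t - s)\<bar>"
      by (simp add: abs_mult mult.commute mult_right_mono)
  qed
  also have "\<dots> = ((\<lambda>s. \<bar>f s\<bar>) \<star> (\<lambda>_. 1)) t * C"
    by (simp add: causal_conv_def)
  finally show ?thesis .
qed

lemma loc_int_abs: "loc_int f \<Longrightarrow> loc_int (\<lambda>s. \<bar>f s\<bar>)"
  unfolding loc_int_def by (auto intro: set_integrable_abs)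

text \<open>The singular factor cannot carry the variable \<open>t\<close>. After commuting,
  \<open>t\<close> occurs only in \<open>w\<close>, extended by 0 to negative arguments as
  \<open>w'\<close>; the extension jumps at most at \<open>s = t\<close>, a null set, so dominated
  convergence applies.\<close>

lemma continuous_causal_conv:
  assumes f: "loc_int f" and w: "continuous_on {0..} w"
  shows "continuous_on {0..} (f \<star> w)"
proof (rule continuous_on_sequentiallyI)
  fix u :: "nat \<Rightarrow> real" and t
  assume u: "\<forall>n. u n \<in> {0..}" and t: "t \<in> {0..}" and lim: "u \<longlonglongrightarrow> t"
  obtain T where T: "\<And>n. u n \<le> T" "t \<le> T"
  proof -
    obtain B where "\<And>n. \<bar>u n\<bar> \<le> B"
      using convergent_imp_bounded[OF lim] unfolding bounded_iff by auto
    then show ?thesis by (intro that[of "max B t"]) (smt (verit))+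
  qed
  obtain C where C: "C \<ge> 0" "\<And>s. 0 \<le> s \<Longrightarrow> s \<le> T \<Longrightarrow> \<bar>w s\<bar> \<le> C"
    using continuous_bounded_Icc[OF w, of T] by blast
  define w' where "w' = (\<lambda>r. indicator {0..} r *\<^sub>R w r)"
  have w'_meas: "w' \<in> borel_measurable borel"
    unfolding w'_def by (intro borel_measurable_continuous_on_indicator w) auto
  have f_int: "integrable lborel (\<lambda>s. indicator {0..T} s *\<^sub>R f s)"
    using loc_intD[OF f, of T] by (simp add: set_integrable_def)
  have eq: "(f \<star> w) r = (LINT s|lborel. w' (r - s) * (indicator {0..T} s *\<^sub>R f s))" if "r \<le> T" for r
  proof -
    have "(f \<star> w) r = (w \<star> f) r" by (simp add: causal_conv_commute[of f w])
    also have "\<dots> = (LINT s|lborel. w' (r - s) * (indicator {0..T} s *\<^sub>R f s))"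
      unfolding causal_conv_def set_lebesgue_integral_def w'_def
      by (rule Bochner_Integration.integral_cong) (use that in \<open>auto simp: indicator_def\<close>)
    finally show ?thesis .
  qed
  have "(\<lambda>n. LINT s|lborel. w' (u n - s) * (indicator {0..T} s *\<^sub>R f s))
     \<longlonglongrightarrow> (LINT s|lborel. w' (t - s) * (indicator {0..T} s *\<^sub>R f s))"
  proof (rule integral_dominated_convergence[where w="\<lambda>s. C * norm (indicator {0..T} s *\<^sub>R f s)"])
    show "integrable lborel (\<lambda>s. C * norm (indicator {0..T} s *\<^sub>R f s))"
      using integrable_norm[OF f_int] by (simp add: mult.commute)
    show "(\<lambda>s. w' (t - s) * (indicator {0..T} s *\<^sub>R f s)) \<in> borel_measurable lborel"
      using w'_meas f_int by measurable
    show "(\<lambda>s. w' (u n - s) * (indicator {0..T} s *\<^sub>R f s)) \<in> borel_measurable lborel" for n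
      using w'_meas f_int by measurable
    show "AE s in lborel. norm (w' (u n - s) * (indicator {0..T} s *\<^sub>R f s)) \<le> C * norm (indicator {0..T} s *\<^sub>R f s)" for n
    proof (rule AE_I2)
      fix s
      have "s \<in> {0..T} \<Longrightarrow> \<bar>w' (u n - s)\<bar> \<le> C"
        using C T(1)[of n] unfolding w'_def indicator_def by (auto simp: C(1))
      then show "norm (w' (u n - s) * (indicator {0..T} s *\<^sub>R f s)) \<le> C * norm (indicator {0..T} s *\<^sub>R f s)"
        by (cases "s \<in> {0..T}") (auto simp: abs_mult intro!: mult_right_mono)
    qed
    have "(\<lambda>n. w' (u n - s)) \<longlonglongrightarrow> w' (t - s)" if "s \<noteq> t" for s
    proof -
      have diff: "(\<lambda>n. u n - s) \<longlonglongrightarrow> t - s" by (intro tendsto_intros lim)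
      show ?thesis
      proof (cases "s < t")
        case True
        have "isCont w (t - s)"
          using continuous_on_interior[OF w, of "t - s"] True by simp
        then have "(\<lambda>n. w (u n - s)) \<longlonglongrightarrow> w (t - s)"
          using diff by (rule isCont_tendsto_compose)
        moreover have "eventually (\<lambda>n. w (u n - s) = w' (u n - s)) sequentially"
          using order_tendstoD(1)[OF diff, of 0] True by (auto simp: w'_def elim!: eventually_mono)
        ultimately show ?thesis
          using True by (simp add: w'_def tendsto_cong)
      next
        case False
        have "eventually (\<lambda>n. w' (u n - s) = 0) sequentially"
          using order_tendstoD(2)[OF diff, of 0] False that by (auto simp: w'_def elim!: eventually_mono)
        then show ?thesis
          using False that by (simp add: w'_def tendsto_eventually)
      qed
    qed
    then have "(\<lambda>n. w' (u n - s) * (indicator {0..T} s *\<^sub>R f s)) \<longlonglongrightarrow> w' (t - s) * (indicator {0..T} s *\<^sub>R f s)"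
      if "s \<noteq> t" for s
      using that by (intro tendsto_intros) auto
    then show "AE s in lborel. (\<lambda>n. w' (u n - s) * (indicator {0..T} s *\<^sub>R f s)) \<longlonglongrightarrow> w' (t - s) * (indicator {0..T} s *\<^sub>R f s)"
      using AE_lborel_singleton[of t] by (auto elim!: eventually_mono)
  qed
  then show "(\<lambda>n. (f \<star> w) (u n)) \<longlonglongrightarrow> (f \<star> w) t"
    by (simp add: eq T)
qed

text \<open>Fubini on the triangle \<open>r \<le> s \<le> t\<close>, with all three functions cut
  off outside \<open>[0, t]\<close>; the product is integrable because \<open>f'\<close> and
  \<open>g'\<close> are in \<open>L^1\<close> and \<open>w'\<close> is bounded. The inner integral
  may diverge for single \<open>r\<close>; substitution then yields the same default value on both
  sides.\<close>

lemma causal_conv_assoc: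
  assumes f: "loc_int f" and g: "loc_int g" and w: "continuous_on {0..} w"
  shows "f \<star> (g \<star> w) = (f \<star> g) \<star> w"
proof
  fix t
  define f' g' w' where "f' = (\<lambda>s. indicator {0..t} s *\<^sub>R f s)" and "g' = (\<lambda>s. indicator {0..t} s *\<^sub>R g s)"
    and "w' = (\<lambda>s. indicator {0..t} s *\<^sub>R w s)"
  have f': "integrable lborel f'" and g': "integrable lborel g'"
    using loc_intD[OF f, of t] loc_intD[OF g, of t] by (simp_all add: f'_def g'_def set_integrable_def)
  have w'_meas: "w' \<in> borel_measurable borel"
    using continuous_set_borel_measurable[OF w, of t] by (simp add: w'_def set_borel_measurable_def)
  note [measurable] = w'_meas borel_measurable_integrable[OF f', simplified] borel_measurable_integrable[OF g', simplified]
  obtain C where C: "C \<ge> 0" "\<And>s. 0 \<le> s \<Longrightarrow> s \<le> t \<Longrightarrow> \<bar>w s\<bar> \<le> C"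
    using continuous_bounded_Icc[OF w, of t] by blast
  have w'_bd: "\<bar>w' s\<bar> \<le> C" for s
    using C by (auto simp: w'_def indicator_def)
  have f'_refl: "integrable lborel (\<lambda>s. f' (t - s))"
    using f' lborel_integrable_real_affine_iff[of "-1" f' t] by simp
  have g'_refl: "integrable lborel (\<lambda>r. g' (s - r))" for s
    using g' lborel_integrable_real_affine_iff[of "-1" g' s] by simp
  have g'w': "integrable lborel (\<lambda>r. g' (s - r) * w' r)" for s
  proof (rule Bochner_Integration.integrable_bound[of _ "\<lambda>r. C * g' (s - r)"])
    show "integrable lborel (\<lambda>r. C * g' (s - r))" using g'_refl by simp
    show "AE r in lborel. norm (g' (s - r) * w' r) \<le> norm (C * g' (s - r))"
      using w'_bd C(1) by (auto simp: abs_mult mult.commute intro!: mult_right_mono)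
  qed measurable
  define F where "F = (\<lambda>s r. f' (t - s) * (g' (s - r) * w' r))"
  have F: "integrable (lborel \<Otimes>\<^sub>M lborel) (\<lambda>(s, r). F s r)"
  proof (rule lborel_pair.Fubini_integrable)
    show "(\<lambda>(s, r). F s r) \<in> borel_measurable (lborel \<Otimes>\<^sub>M lborel)"
      unfolding F_def by measurable
    show "AE s in lborel. integrable lborel (\<lambda>r. case (s, r) of (s, r) \<Rightarrow> F s r)"
      using g'w' by (simp add: F_def)
    show "integrable lborel (\<lambda>s. LINT r|lborel. norm (case (s, r) of (s, r) \<Rightarrow> F s r))"
    proof (rule Bochner_Integration.integrable_bound)
      show "integrable lborel (\<lambda>s. (C * (LINT r|lborel. \<bar>g' r\<bar>)) * f' (t - s))"
        using f'_refl by simp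
      show "(\<lambda>s. LINT r|lborel. norm (case (s, r) of (s, r) \<Rightarrow> F s r)) \<in> borel_measurable lborel"
        unfolding F_def by measurable
      have "(LINT r|lborel. \<bar>F s r\<bar>) \<le> (C * (LINT r|lborel. \<bar>g' r\<bar>)) * \<bar>f' (t - s)\<bar>" for s
      proof -
        have "(LINT r|lborel. \<bar>F s r\<bar>) = \<bar>f' (t - s)\<bar> * (LINT r|lborel. \<bar>g' (s - r) * w' r\<bar>)"
          by (simp add: F_def abs_mult)
        also have "(LINT r|lborel. \<bar>g' (s - r) * w' r\<bar>) \<le> (LINT r|lborel. C * \<bar>g' (s - r)\<bar>)"
        proof (rule integral_mono)
          show "integrable lborel (\<lambda>r. \<bar>g' (s - r) * w' r\<bar>)"
            using g'w'[of s] by (rule integrable_abs)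
          show "integrable lborel (\<lambda>r. C * \<bar>g' (s - r)\<bar>)"
            using g'_refl[of s] by simp
          show "\<bar>g' (s - r) * w' r\<bar> \<le> C * \<bar>g' (s - r)\<bar>" for r
            using w'_bd by (simp add: abs_mult mult.commute mult_right_mono)
        qed
        also have "\<dots> = C * (LINT r|lborel. \<bar>g' r\<bar>)"
          using lborel_integral_real_affine[of "-1" "\<lambda>r. \<bar>g' r\<bar>" s] by simp
        finally have "(LINT r|lborel. \<bar>F s r\<bar>) \<le> \<bar>f' (t - s)\<bar> * (C * (LINT r|lborel. \<bar>g' r\<bar>))"
          by (simp add: mult_left_mono)
        then show ?thesis
          by (simp add: mult_ac)
      qed
      then show "AE s in lborel. norm (LINT r|lborel. norm (case (s, r) of (s, r) \<Rightarrow> F s r))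
           \<le> norm (C * (LINT r|lborel. \<bar>g' r\<bar>) * f' (t - s))"
        using C(1) by (intro AE_I2) (simp add: abs_mult)
    qed
  qed
  have "(f \<star> (g \<star> w)) t = (LINT s|lborel. f' (t - s) * (LINT r|lborel. g' (s - r) * w' r))"
    unfolding causal_conv_def[of f] set_lebesgue_integral_def
  proof (rule Bochner_Integration.integral_cong[OF refl])
    fix s
    show "indicator {0..t} s *\<^sub>R (f (t - s) * (g \<star> w) s) = f' (t - s) * (LINT r|lborel. g' (s - r) * w' r)"
    proof (cases "s \<in> {0..t}")
      case True
      have "(g \<star> w) s = (LINT r|lborel. g' (s - r) * w' r)"
        unfolding causal_conv_def set_lebesgue_integral_def
        by (rule Bochner_Integration.integral_cong) (use True in \<open>auto simp: g'_def w'_def indicator_def\<close>)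
      then show ?thesis using True by (simp add: f'_def)
    qed (auto simp: f'_def indicator_def)
  qed
  also have "\<dots> = (LINT s|lborel. LINT r|lborel. F s r)"
    by (simp add: F_def)
  also have "\<dots> = (LINT r|lborel. LINT s|lborel. F s r)"
    by (rule lborel_pair.Fubini_integral[symmetric, OF F])
  also have "\<dots> = ((f \<star> g) \<star> w) t"
    unfolding causal_conv_def[of "f \<star> g"] set_lebesgue_integral_def
  proof (rule Bochner_Integration.integral_cong[OF refl])
    fix r
    show "(LINT s|lborel. F s r) = indicator {0..t} r *\<^sub>R ((f \<star> g) (t - r) * w r)"
    proof (cases "r \<in> {0..t}")
      case True
      have "(f \<star> g) (t - r) = (LINT s|lborel. f' (t - s) * g' (s - r))"
        unfolding causal_conv_def set_lebesgue_integral_def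
        by (subst lborel_integral_real_affine[where c=1 and t="-r"], simp, simp,
            rule Bochner_Integration.integral_cong)
          (use True in \<open>auto simp: f'_def g'_def indicator_def algebra_simps\<close>)
      moreover have "(LINT s|lborel. F s r) = (LINT s|lborel. f' (t - s) * g' (s - r)) * w' r"
        by (simp add: F_def mult.assoc[symmetric])
      ultimately show ?thesis using True by (simp add: w'_def)
    qed (auto simp: F_def w'_def)
  qed
  finally show "(f \<star> (g \<star> w)) t = ((f \<star> g) \<star> w) t" .
qed

section \<open>Riemann-Liouville kernels and the Mittag-Leffler function\<close>

text \<open>Convolution with \<open>rl_kernel \<beta>\<close> is the fractional integral of order
  \<open>\<beta>\<close>. The value at 0 is 0 for every \<open>\<beta>\<close>, in line with
  \<open>0 powr p = 0\<close>, so \<open>rl_kernel 1\<close> agrees with the constant 1 on the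
  half-line only up to the null set \<open>{0}\<close>.\<close>

definition rl_kernel :: "real \<Rightarrow> real \<Rightarrow> real"
  where "rl_kernel \<beta> t = (if t > 0 then t powr (\<beta> - 1) / Gamma \<beta> else 0)"

lemma rl_kernel_nonneg: "\<beta> > 0 \<Longrightarrow> rl_kernel \<beta> t \<ge> 0"
  by (simp add: rl_kernel_def Gamma_real_pos less_imp_le)

lemma rl_kernel_pos: "\<beta> > 0 \<Longrightarrow> t > 0 \<Longrightarrow> rl_kernel \<beta> t > 0"
  by (simp add: rl_kernel_def Gamma_real_pos)

lemma rl_kernel_eq: "t \<ge> 0 \<Longrightarrow> rl_kernel \<beta> t = t powr (\<beta> - 1) / Gamma \<beta>"
  by (cases "t = 0") (auto simp: rl_kernel_def)

lemma powr_set_integrable: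
  assumes "p > -1"
  shows "set_integrable lborel {0..T} (\<lambda>t::real. t powr p)"
proof (cases "T \<ge> 0")
  case True
  have "(\<lambda>t. t powr p) absolutely_integrable_on {0..T}"
    using integrable_on_powr_from_0[OF assms True] by (subst absolutely_integrable_on_iff_nonneg) auto
  then show ?thesis
    unfolding set_integrable_def by (subst (asm) integrable_completion) auto
qed (simp add: set_integrable_def)

lemma loc_int_rl_kernel:
  assumes "\<beta> > 0"
  shows "loc_int (rl_kernel \<beta>)"
  unfolding loc_int_def
proof
  fix T
  have "set_integrable lborel {0..T} (\<lambda>t. t powr (\<beta> - 1) / Gamma \<beta>)"
    using powr_set_integrable[of "\<beta> - 1" T] assms by simp
  also have "?this \<longleftrightarrow> set_integrable lborel {0..T} (rl_kernel \<beta>)"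
    by (rule set_integrable_cong) (auto simp: rl_kernel_eq)
  finally show "set_integrable lborel {0..T} (rl_kernel \<beta>)" .
qed

lemma rl_kernel_scale:
  assumes "t > 0" "u \<in> {0..1}"
  shows "rl_kernel \<beta> (t - t * u) * rl_kernel \<gamma> (t * u) =
    (t powr (\<beta> + \<gamma> - 2) / (Gamma \<beta> * Gamma \<gamma>)) * (u powr (\<gamma> - 1) * (1 - u) powr (\<beta> - 1))"
proof -
  have *: "t - t * u = t * (1 - u)" by (simp add: algebra_simps)
  have "rl_kernel \<beta> (t * (1 - u)) = t powr (\<beta> - 1) * (1 - u) powr (\<beta> - 1) / Gamma \<beta>"
    using assms by (subst rl_kernel_eq) (auto simp: powr_mult)
  moreover have "rl_kernel \<gamma> (t * u) = t powr (\<gamma> - 1) * u powr (\<gamma> - 1) / Gamma \<gamma>"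
    using assms by (subst rl_kernel_eq) (auto simp: powr_mult)
  moreover have "t powr (\<beta> + \<gamma> - 2) = t powr (\<beta> - 1) * t powr (\<gamma> - 1)"
    by (simp add: powr_add[symmetric] algebra_simps)
  ultimately show ?thesis by (simp add: *)
qed

text \<open>The semigroup law of fractional integration: \<open>s = t * u\<close> turns the
  convolution into the Beta integral, and dividing by \<open>Gamma \<beta> * Gamma \<gamma>\<close>
  leaves \<open>1 / Gamma (\<beta> + \<gamma>)\<close>. Integrability is a claim of its own, since
  both factors may be singular.\<close>

lemma
  assumes "\<beta> > 0" "\<gamma> > 0"
  shows rl_kernel_conv_integrable:
      "set_integrable lborel {0..t} (\<lambda>s. rl_kernel \<beta> (t - s) * rl_kernel \<gamma> s)"
    and rl_kernel_conv: "rl_kernel \<beta> \<star> rl_kernel \<gamma> = rl_kernel (\<beta> + \<gamma>)"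
proof -
  define B where "B = (\<lambda>u::real. u powr (\<gamma> - 1) * (1 - u) powr (\<beta> - 1))"
  define S where "S = (\<lambda>t s. indicator {0..t} s *\<^sub>R (rl_kernel \<beta> (t - s) * rl_kernel \<gamma> s))"
  have B_int: "set_integrable lborel {0..1} B"
    unfolding B_def using integrable_Beta assms by blast
  have S: "S t (0 + t * u) = (t powr (\<beta> + \<gamma> - 2) / (Gamma \<beta> * Gamma \<gamma>)) * (indicator {0..1} u *\<^sub>R B u)"
    if "t > 0" for t u
  proof (cases "u \<in> {0..1}")
    case True
    then show ?thesis
      using that rl_kernel_scale[OF that True, of \<beta> \<gamma>]
      by (simp add: S_def B_def mult_le_cancel_left1)
  next
    case False
    then have "t * u \<notin> {0..t}"
      using that by (auto simp: zero_le_mult_iff)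
    then show ?thesis using False by (simp add: S_def)
  qed
  have int: "integrable lborel (S t)" if "t > 0" for t
    using B_int that unfolding set_integrable_def
    by (subst lborel_integrable_real_affine_iff[where c=t and t=0, symmetric]) (auto simp only: S integrable_mult_right less_irrefl)
  then show "set_integrable lborel {0..t} (\<lambda>s. rl_kernel \<beta> (t - s) * rl_kernel \<gamma> s)"
  proof (cases "t > 0")
    case False
    then have "(\<lambda>s. indicator {0..t} s *\<^sub>R (rl_kernel \<beta> (t - s) * rl_kernel \<gamma> s)) = (\<lambda>_. 0)"
      by (auto simp: indicator_def rl_kernel_def)
    then show ?thesis by (simp add: set_integrable_def)
  qed (auto simp: S_def set_integrable_def)
  show "rl_kernel \<beta> \<star> rl_kernel \<gamma> = rl_kernel (\<beta> + \<gamma>)"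
  proof
    fix t
    show "(rl_kernel \<beta> \<star> rl_kernel \<gamma>) t = rl_kernel (\<beta> + \<gamma>) t"
    proof (cases "t > 0")
      case True
      have "(rl_kernel \<beta> \<star> rl_kernel \<gamma>) t = t * (LINT u|lborel. S t (0 + t * u))"
        using True unfolding causal_conv_def set_lebesgue_integral_def S_def
        by (subst lborel_integral_real_affine[where c=t and t=0]) auto
      also have "\<dots> = t * (t powr (\<beta> + \<gamma> - 2) / (Gamma \<beta> * Gamma \<gamma>)) * (LINT u:{0..1}|lborel. B u)"
        unfolding S[OF True] by (simp add: set_lebesgue_integral_def)
      also have "(LINT u:{0..1}|lborel. B u) = Beta \<gamma> \<beta>"
        using set_borel_integral_eq_integral(2)[OF B_int] has_integral_Beta_real[of \<gamma> \<beta>] assms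
        by (simp add: B_def integral_unique)
      also have "t * (t powr (\<beta> + \<gamma> - 2) / (Gamma \<beta> * Gamma \<gamma>)) * Beta \<gamma> \<beta> = (t * t powr (\<beta> + \<gamma> - 2)) / Gamma (\<beta> + \<gamma>)"
        using Gamma_real_pos[OF assms(1)] Gamma_real_pos[OF assms(2)] by (simp add: Beta_def add.commute)
      also have "t * t powr (\<beta> + \<gamma> - 2) = t powr (\<beta> + \<gamma> - 1)"
        using True by (simp add: powr_mult_base)
      finally show ?thesis using True by (simp add: rl_kernel_def[of "\<beta> + \<gamma>"])
    qed (simp add: causal_conv_nonpos rl_kernel_def)
  qed
qed

lemma rl_kernel_1_conv:
  assumes "continuous_on {0..} w"
  shows "(rl_kernel 1 \<star> w) t = integral {0..t} w"
proof -
  have "(rl_kernel 1 \<star> w) t = integral {0..t} (\<lambda>s. rl_kernel 1 (t - s) * w s)"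
    unfolding causal_conv_def
    by (intro set_borel_integral_eq_integral causal_conv_integrable loc_int_rl_kernel assms) auto
  also have "\<dots> = integral {0..t} w"
    by (rule integral_spike[of "{t}"]) (auto simp: rl_kernel_def)
  finally show ?thesis .
qed

text \<open>Euler's integral restricted to \<open>[M, M + 1]\<close>. As \<open>M\<close> is free,
  this beats every geometric growth rate, which is what convergence of the Mittag-Leffler series
  asks for.\<close>

lemma Gamma_ge_powr:
  fixes M x :: real
  assumes "x \<ge> 1" "M > 0"
  shows "Gamma x \<ge> M powr (x - 1) * exp (-(M + 1))"
proof -
  define g where "g = (\<lambda>t::real. t powr (x - 1) / exp t)"
  have "continuous_on {M..M+1} g"
    unfolding g_def using assms by (intro continuous_intros) auto
  then have g: "(g has_integral integral {M..M+1} g) {M..M+1}"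
    by (intro integrable_integral integrable_continuous_interval)
  have "((\<lambda>_. M powr (x - 1) * exp (-(M + 1))) has_integral M powr (x - 1) * exp (-(M + 1))) {M..M+1}"
    using has_integral_const_real[of "M powr (x - 1) * exp (-(M + 1))" M "M+1"] by simp
  then have "M powr (x - 1) * exp (-(M + 1)) \<le> integral {M..M+1} g"
  proof (rule has_integral_le[OF _ g])
    fix t assume "t \<in> {M..M+1}"
    then show "M powr (x - 1) * exp (-(M + 1)) \<le> g t"
      unfolding g_def divide_inverse exp_minus[symmetric]
      using assms by (intro mult_mono powr_mono2) auto
  qed
  also have "integral {M..M+1} g \<le> Gamma x"
  proof (rule has_integral_subset_le[OF _ g])
    show "(g has_integral Gamma x) {0..}"
      unfolding g_def using Gamma_integral_real assms by simp
  qed (use assms in \<open>auto simp: g_def\<close>)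
  finally show ?thesis .
qed

text \<open>This is the two-parameter function \<open>E\<^sub>\<alpha>\<^sub>,\<^sub>\<alpha>\<close>, not \<open>E\<^sub>\<alpha>\<close>.\<close>
definition mittag_leffler :: "real \<Rightarrow> real \<Rightarrow> real"
  where "mittag_leffler \<alpha> z = (\<Sum>n. z ^ n / Gamma (real (Suc n) * \<alpha>))"

lemma summable_mittag_leffler:
  fixes z :: real
  assumes "\<alpha> > 0"
  shows "summable (\<lambda>n. \<bar>z\<bar> ^ n / Gamma (real (Suc n) * \<alpha>))"
proof -
  \<comment> \<open>\<open>M\<close> is the solution of \<open>M powr \<alpha> = A\<close>, so the
    lower bound for \<open>Gamma (real (Suc n) * \<alpha>)\<close> becomes
    \<open>A ^ Suc n / C\<close>; the factor 2 in \<open>A\<close> makes the ratio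
    \<open>\<bar>z\<bar> / A\<close> at most 1/2. \<open>N\<close> only ensures that the argument of
    \<open>Gamma\<close> is at least 1.\<close>
  define A where "A = 2 * (\<bar>z\<bar> + 1)"
  define M where "M = A powr (1 / \<alpha>)"
  have A: "A > 0" and M: "M > 0" by (auto simp: A_def M_def)
  define C where "C = M * exp (M + 1)"
  obtain N :: nat where N: "real N \<ge> 1 / \<alpha>" using real_arch_simple by blast
  show ?thesis
  proof (rule summable_comparison_test')
    show "summable (\<lambda>n. C * (1/2) ^ n)" by (intro summable_mult summable_geometric) auto
    fix n assume "n \<ge> N"
    then have "real (Suc n) \<ge> 1 / \<alpha>" using N by linarith
    then have n: "real (Suc n) * \<alpha> \<ge> 1" using assms by (simp add: field_simps)
    have "M powr (real (Suc n) * \<alpha> - 1) = A powr real (Suc n) / M"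
      using M assms by (simp add: powr_diff M_def powr_powr)
    also have "\<dots> = A ^ Suc n / M"
      using A by (subst powr_realpow) auto
    finally have "Gamma (real (Suc n) * \<alpha>) \<ge> A ^ Suc n / M * exp (-(M + 1))"
      using Gamma_ge_powr[OF n M] by simp
    moreover have "A ^ Suc n / M * exp (-(M + 1)) = A ^ Suc n / C"
      unfolding C_def exp_minus by (simp add: divide_inverse)
    ultimately have G: "Gamma (real (Suc n) * \<alpha>) \<ge> A ^ Suc n / C"
      by simp
    have AC: "A ^ Suc n / C > 0" using A M by (simp add: C_def)
    have "\<bar>z\<bar> ^ n / Gamma (real (Suc n) * \<alpha>) \<le> \<bar>z\<bar> ^ n / (A ^ Suc n / C)"
      using G AC less_le_trans[OF AC G] by (intro divide_left_mono mult_pos_pos) auto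
    also have "\<dots> = C * (\<bar>z\<bar> ^ n / A ^ n) / A"
      by (simp add: field_simps)
    also have "\<dots> \<le> C * (1/2) ^ n"
    proof -
      have "\<bar>z\<bar> / A \<le> 1/2" using A by (simp add: A_def field_simps)
      then have "(\<bar>z\<bar> / A) ^ n \<le> (1/2) ^ n" using A by (intro power_mono) auto
      moreover have "A \<ge> 1" "C \<ge> 0" using M by (auto simp: A_def C_def)
      ultimately have "C * (\<bar>z\<bar> / A) ^ n * 1 \<le> C * (1/2) ^ n * A"
        by (intro mult_mono mult_nonneg_nonneg) auto
      then show ?thesis using A by (simp add: power_divide field_simps)
    qed
    finally show "norm (\<bar>z\<bar> ^ n / Gamma (real (Suc n) * \<alpha>)) \<le> C * (1/2) ^ n"
      using G AC by simp
  qed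
qed

lemma continuous_mittag_leffler:
  assumes "\<alpha> > 0"
  shows "continuous_on A (mittag_leffler \<alpha>)"
proof -
  have "summable (\<lambda>n. inverse (Gamma (real (Suc n) * \<alpha>)) * y ^ n)" for y
  proof (rule summable_norm_cancel)
    show "summable (\<lambda>n. norm (inverse (Gamma (real (Suc n) * \<alpha>)) * y ^ n))"
      using summable_mittag_leffler[OF assms, of y] Gamma_real_pos assms
      by (simp add: abs_mult power_abs divide_inverse mult.commute abs_of_pos)
  qed
  then have "isCont (\<lambda>x. \<Sum>n. inverse (Gamma (real (Suc n) * \<alpha>)) * x ^ n) z" for z
    by (rule isCont_powser_converges_everywhere)
  then show ?thesis
    unfolding mittag_leffler_def[abs_def] divide_inverse
    by (intro continuous_at_imp_continuous_on) (simp add: mult.commute)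
qed

section \<open>The resolvent of the Riemann-Liouville kernel\<close>

text \<open>Closed form of the Neumann series with terms \<open>(-1)^n \<mu>^(n+1)\<close> times the
  \<open>(n+1)\<close>-fold convolution power of \<open>rl_kernel \<alpha>\<close>. The series
  yields the resolvent equation; the closed form yields continuity off 0 and the bound
  \<open>C * t powr (\<alpha> - 1)\<close>.\<close>

definition resolvent_kernel :: "real \<Rightarrow> real \<Rightarrow> real \<Rightarrow> real" where
  "resolvent_kernel \<alpha> \<mu> t =
     (if t > 0 then \<mu> * t powr (\<alpha> - 1) * mittag_leffler \<alpha> (- (\<mu> * t powr \<alpha>)) else 0)"

lemma summable_rl_kernel:
  assumes "\<alpha> > 0" "\<mu> > 0"
  shows "summable (\<lambda>n. \<mu> ^ Suc n * rl_kernel (real (Suc n) * \<alpha>) t)"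
proof (cases "t > 0")
  case True
  have "\<mu> ^ Suc n * rl_kernel (real (Suc n) * \<alpha>) t =
      (\<mu> * t powr (\<alpha> - 1)) * (\<bar>\<mu> * t powr \<alpha>\<bar> ^ n / Gamma (real (Suc n) * \<alpha>))" for n
  proof -
    have "t powr (real (Suc n) * \<alpha> - 1) = t powr (\<alpha> - 1) * (t powr \<alpha>) powr real n"
      by (simp add: powr_powr powr_add[symmetric] algebra_simps)
    also have "(t powr \<alpha>) powr real n = (t powr \<alpha>) ^ n"
      using True by (subst powr_realpow) auto
    finally show ?thesis
      using True assms by (simp add: rl_kernel_def power_mult_distrib abs_mult)
  qed
  then show ?thesis
    using summable_mult[OF summable_mittag_leffler[OF assms(1), of "\<mu> * t powr \<alpha>"]] by presburger
qed (simp add: rl_kernel_def)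

lemma resolvent_kernel_sums:
  assumes "\<alpha> > 0" "\<mu> > 0"
  shows "(\<lambda>n. (-1) ^ n * \<mu> ^ Suc n * rl_kernel (real (Suc n) * \<alpha>) t) sums resolvent_kernel \<alpha> \<mu> t"
proof (cases "t > 0")
  case True
  have "(-1) ^ n * \<mu> ^ Suc n * rl_kernel (real (Suc n) * \<alpha>) t =
      (\<mu> * t powr (\<alpha> - 1)) * ((- (\<mu> * t powr \<alpha>)) ^ n / Gamma (real (Suc n) * \<alpha>))" for n
  proof -
    have "t powr (real (Suc n) * \<alpha> - 1) = t powr (\<alpha> - 1) * (t powr \<alpha>) powr real n"
      by (simp add: powr_powr powr_add[symmetric] algebra_simps)
    also have "(t powr \<alpha>) powr real n = (t powr \<alpha>) ^ n"
      using True by (subst powr_realpow) auto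
    finally show ?thesis
      using True assms by (simp add: rl_kernel_def power_mult_distrib power_minus[of "\<mu> * t powr \<alpha>"])
  qed
  moreover have "(\<lambda>n. (- (\<mu> * t powr \<alpha>)) ^ n / Gamma (real (Suc n) * \<alpha>)) sums mittag_leffler \<alpha> (- (\<mu> * t powr \<alpha>))"
    unfolding mittag_leffler_def
  proof (rule summable_sums, rule summable_norm_cancel)
    show "summable (\<lambda>n. norm ((- (\<mu> * t powr \<alpha>)) ^ n / Gamma (real (Suc n) * \<alpha>)))"
      using summable_mittag_leffler[OF assms(1), of "\<mu> * t powr \<alpha>"] Gamma_real_pos assms(1)
      by (simp add: power_abs abs_of_pos)
  qed
  ultimately show ?thesis
    using True by (simp only: resolvent_kernel_def if_True sums_mult)
qed (simp add: rl_kernel_def resolvent_kernel_def)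

lemma continuous_resolvent_kernel:
  assumes "\<alpha> > 0"
  shows "continuous_on {0<..} (resolvent_kernel \<alpha> \<mu>)"
proof -
  have "continuous_on {0<..} (\<lambda>t. \<mu> * t powr (\<alpha> - 1) * mittag_leffler \<alpha> (- (\<mu> * t powr \<alpha>)))"
    by (intro continuous_intros continuous_on_compose2[OF continuous_mittag_leffler[OF assms, of UNIV]]) auto
  then show ?thesis
    by (rule continuous_on_eq) (auto simp: resolvent_kernel_def)
qed

lemma resolvent_kernel_abs_le:
  assumes "\<alpha> > 0"
  obtains C where "\<And>t. 0 \<le> t \<Longrightarrow> t \<le> T \<Longrightarrow> \<bar>resolvent_kernel \<alpha> \<mu> t\<bar> \<le> C * t powr (\<alpha> - 1)"
proof -
  have "continuous_on {0..T} (\<lambda>t. \<mu> * mittag_leffler \<alpha> (- (\<mu> * t powr \<alpha>)))"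
    using assms
    by (intro continuous_intros continuous_on_compose2[OF continuous_mittag_leffler[OF assms, of UNIV]]
        continuous_on_powr') auto
  then have "bounded ((\<lambda>t. \<mu> * mittag_leffler \<alpha> (- (\<mu> * t powr \<alpha>))) ` {0..T})"
    by (intro compact_imp_bounded compact_continuous_image) auto
  then obtain C where C: "\<forall>t\<in>{0..T}. \<bar>\<mu> * mittag_leffler \<alpha> (- (\<mu> * t powr \<alpha>))\<bar> \<le> C"
    unfolding bounded_iff by auto
  show ?thesis
  proof
    fix t assume "0 \<le> t" "t \<le> T"
    then have "\<bar>\<mu> * mittag_leffler \<alpha> (- (\<mu> * t powr \<alpha>))\<bar> * t powr (\<alpha> - 1) \<le> C * t powr (\<alpha> - 1)"
      using C by (intro mult_right_mono) auto
    then show "\<bar>resolvent_kernel \<alpha> \<mu> t\<bar> \<le> C * t powr (\<alpha> - 1)"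
      using \<open>0 \<le> t\<close> by (cases "t = 0") (auto simp: resolvent_kernel_def abs_mult algebra_simps)
  qed
qed

lemma loc_int_resolvent_kernel:
  assumes "\<alpha> > 0"
  shows "loc_int (resolvent_kernel \<alpha> \<mu>)"
  unfolding loc_int_def
proof
  fix T
  obtain C where C: "\<And>t. 0 \<le> t \<Longrightarrow> t \<le> T \<Longrightarrow> \<bar>resolvent_kernel \<alpha> \<mu> t\<bar> \<le> C * t powr (\<alpha> - 1)"
    using resolvent_kernel_abs_le[OF assms] by blast
  show "set_integrable lborel {0..T} (resolvent_kernel \<alpha> \<mu>)"
    unfolding set_integrable_def
  proof (rule Bochner_Integration.integrable_bound)
    have "set_integrable lborel {0..T} (\<lambda>t. C * t powr (\<alpha> - 1))"
      using powr_set_integrable[of "\<alpha> - 1" T] assms by simp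
    then show "integrable lborel (\<lambda>t. indicator {0..T} t *\<^sub>R (C * t powr (\<alpha> - 1)))"
      by (simp add: set_integrable_def)
    have "(\<lambda>t. indicator {0<..} t *\<^sub>R resolvent_kernel \<alpha> \<mu> t) \<in> borel_measurable borel"
      by (intro borel_measurable_continuous_on_indicator continuous_resolvent_kernel assms) auto
    moreover have "(\<lambda>t. indicator {0<..} t *\<^sub>R resolvent_kernel \<alpha> \<mu> t) = resolvent_kernel \<alpha> \<mu>"
      by (auto simp: resolvent_kernel_def indicator_def)
    ultimately have [measurable]: "resolvent_kernel \<alpha> \<mu> \<in> borel_measurable borel"
      by simp
    show "(\<lambda>t. indicator {0..T} t *\<^sub>R resolvent_kernel \<alpha> \<mu> t) \<in> borel_measurable lborel"
      by measurable
    show "AE t in lborel. norm (indicator {0..T} t *\<^sub>R resolvent_kernel \<alpha> \<mu> t)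
        \<le> norm (indicator {0..T} t *\<^sub>R (C * t powr (\<alpha> - 1)))"
      using C by (intro AE_I2) (fastforce simp: indicator_def)
  qed
qed

text \<open>Convolving the Neumann series termwise with \<open>rl_kernel \<alpha>\<close> raises
  each convolution power by one, which reproduces the series without its first term, up to the
  factor \<open>-1/\<mu>\<close>. Sum and integral may be exchanged because the absolute terms
  integrate to a convergent series of the same type.\<close>

lemma rl_kernel_conv_resolvent:
  assumes "\<alpha> > 0" "\<mu> > 0"
  shows "rl_kernel \<alpha> \<star> resolvent_kernel \<alpha> \<mu> = (\<lambda>t. rl_kernel \<alpha> t + (- (1/\<mu>)) * resolvent_kernel \<alpha> \<mu> t)"
proof
  fix t
  define c where "c = (\<lambda>n::nat. (-1) ^ n * \<mu> ^ Suc n)"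
  define q where "q = (\<lambda>n. rl_kernel (real (Suc n) * \<alpha>))"
  define S where "S = (\<lambda>n s. indicator {0..t} s *\<^sub>R (c n * (rl_kernel \<alpha> (t - s) * q n s)))"
  have q_conv: "(LINT s:{0..t}|lborel. rl_kernel \<alpha> (t - s) * q n s) = q (Suc n) t" for n
  proof -
    have "(rl_kernel \<alpha> \<star> q n) t = q (Suc n) t"
      unfolding q_def using rl_kernel_conv[OF assms(1), of "real (Suc n) * \<alpha>"] assms(1)
      by (simp add: distrib_right add_pos_nonneg)
    then show ?thesis by (simp add: causal_conv_def)
  qed
  have q_int: "set_integrable lborel {0..t} (\<lambda>s. rl_kernel \<alpha> (t - s) * q n s)" for n
    unfolding q_def by (intro rl_kernel_conv_integrable) (use assms in auto)
  have abs_c: "\<bar>c n\<bar> = \<mu> ^ Suc n" for n using assms by (simp add: c_def abs_mult)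
  have q_nonneg: "q n s \<ge> 0" for n s
    unfolding q_def using assms by (intro rl_kernel_nonneg) auto
  have nS: "norm (S n s) = \<mu> ^ Suc n * (indicator {0..t} s *\<^sub>R (rl_kernel \<alpha> (t - s) * q n s))" for n s
    using rl_kernel_nonneg[OF assms(1)] q_nonneg by (simp add: S_def abs_mult abs_c)
  have sum_q: "summable (\<lambda>n. \<mu> ^ Suc n * q n s)" for s
    unfolding q_def by (rule summable_rl_kernel[OF assms])
  have S_sums: "(\<lambda>n. S n s) sums (indicator {0..t} s *\<^sub>R (rl_kernel \<alpha> (t - s) * resolvent_kernel \<alpha> \<mu> s))" for s
  proof -
    have "(\<lambda>n. (indicator {0..t} s * rl_kernel \<alpha> (t - s)) * (c n * q n s)) sums
        ((indicator {0..t} s * rl_kernel \<alpha> (t - s)) * resolvent_kernel \<alpha> \<mu> s)"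
      unfolding c_def q_def by (intro sums_mult resolvent_kernel_sums assms)
    then show ?thesis by (simp add: S_def mult_ac)
  qed
  have "(\<lambda>n. integral\<^sup>L lborel (S n)) sums (LINT s|lborel. (\<Sum>n. S n s))"
  proof (rule sums_integral)
    show "integrable lborel (S n)" for n
      using q_int[of n] unfolding S_def set_integrable_def by (simp add: mult.left_commute)
    show "AE s in lborel. summable (\<lambda>n. norm (S n s))"
    proof (rule AE_I2)
      fix s
      show "summable (\<lambda>n. norm (S n s))"
        using summable_mult[OF sum_q[of s], of "indicator {0..t} s * rl_kernel \<alpha> (t - s)"]
        unfolding nS by (simp add: mult_ac)
    qed
    have "(LINT s|lborel. norm (S n s)) = \<mu> ^ Suc n * q (Suc n) t" for n
      unfolding nS using q_conv[of n] by (simp add: set_lebesgue_integral_def)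
    moreover have "summable (\<lambda>n. \<mu> ^ Suc n * q (Suc n) t)"
    proof -
      have "summable (\<lambda>n. \<mu> ^ Suc (Suc n) * q (Suc n) t)"
        using sum_q[of t] by (subst summable_Suc_iff[of "\<lambda>n. \<mu> ^ Suc n * q n t"])
      then have "summable (\<lambda>n. (1/\<mu>) * (\<mu> ^ Suc (Suc n) * q (Suc n) t))"
        by (rule summable_mult)
      moreover have "(1/\<mu>) * (\<mu> ^ Suc (Suc n) * q (Suc n) t) = \<mu> ^ Suc n * q (Suc n) t" for n
        using assms by simp
      ultimately show ?thesis by (simp only:)
    qed
    ultimately show "summable (\<lambda>n. LINT s|lborel. norm (S n s))" by simp
  qed
  moreover have "integral\<^sup>L lborel (S n) = - (1/\<mu>) * (c (Suc n) * q (Suc n) t)" for n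
  proof -
    have "S n = (\<lambda>s. c n * (indicator {0..t} s *\<^sub>R (rl_kernel \<alpha> (t - s) * q n s)))"
      by (simp add: S_def mult.left_commute)
    then have "integral\<^sup>L lborel (S n) = c n * q (Suc n) t"
      using q_conv[of n] by (simp add: set_lebesgue_integral_def)
    then show ?thesis using assms by (simp add: c_def)
  qed
  moreover have "(LINT s|lborel. (\<Sum>n. S n s)) = (rl_kernel \<alpha> \<star> resolvent_kernel \<alpha> \<mu>) t"
    unfolding causal_conv_def set_lebesgue_integral_def
    by (rule Bochner_Integration.integral_cong[OF refl sums_unique[OF S_sums, symmetric]])
  ultimately have 1: "(\<lambda>n. - (1/\<mu>) * (c (Suc n) * q (Suc n) t)) sums (rl_kernel \<alpha> \<star> resolvent_kernel \<alpha> \<mu>) t"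
    by simp
  have "(\<lambda>n. c n * q n t) sums resolvent_kernel \<alpha> \<mu> t"
    unfolding c_def q_def by (rule resolvent_kernel_sums[OF assms])
  then have "(\<lambda>n. c (Suc n) * q (Suc n) t) sums (resolvent_kernel \<alpha> \<mu> t - c 0 * q 0 t)"
    by (subst sums_Suc_iff) simp
  then have "(\<lambda>n. - (1/\<mu>) * (c (Suc n) * q (Suc n) t)) sums (- (1/\<mu>) * (resolvent_kernel \<alpha> \<mu> t - c 0 * q 0 t))"
    by (rule sums_mult)
  with 1 have "(rl_kernel \<alpha> \<star> resolvent_kernel \<alpha> \<mu>) t = - (1/\<mu>) * (resolvent_kernel \<alpha> \<mu> t - c 0 * q 0 t)"
    by (rule sums_unique2)
  also have "\<dots> = rl_kernel \<alpha> t + (- (1/\<mu>)) * resolvent_kernel \<alpha> \<mu> t"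
    using assms by (simp add: c_def q_def right_diff_distrib)
  finally show "(rl_kernel \<alpha> \<star> resolvent_kernel \<alpha> \<mu>) t = rl_kernel \<alpha> t + (- (1/\<mu>)) * resolvent_kernel \<alpha> \<mu> t" .
qed

section \<open>Positivity of the resolvent kernel\<close>

lemma resolvent_kernel_pos_near_0:
  assumes "\<alpha> > 0" "\<mu> > 0"
  obtains e where "e > 0" "\<And>t. 0 < t \<Longrightarrow> t < e \<Longrightarrow> resolvent_kernel \<alpha> \<mu> t > 0"
proof -
  have "continuous_on {0..} (\<lambda>t. mittag_leffler \<alpha> (- (\<mu> * t powr \<alpha>)))"
    using assms
    by (intro continuous_intros continuous_on_compose2[OF continuous_mittag_leffler[OF assms(1), of UNIV]]
        continuous_on_powr') auto
  then have "((\<lambda>t. mittag_leffler \<alpha> (- (\<mu> * t powr \<alpha>))) \<longlongrightarrow> mittag_leffler \<alpha> 0) (at 0 within {0..})"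
    unfolding continuous_on_def using assms by (auto dest!: bspec[of _ _ 0])
  moreover have "mittag_leffler \<alpha> 0 > 0"
  proof -
    have "(\<lambda>n. 0 ^ n / Gamma (real (Suc n) * \<alpha>)) sums (0 ^ 0 / Gamma (real (Suc 0) * \<alpha>))"
      using sums_finite[of "{0}" "\<lambda>n. 0 ^ n / Gamma (real (Suc n) * \<alpha>)"] by simp
    then show ?thesis
      using assms Gamma_real_pos by (simp add: mittag_leffler_def sums_unique[symmetric])
  qed
  ultimately have "eventually (\<lambda>t. mittag_leffler \<alpha> (- (\<mu> * t powr \<alpha>)) > 0) (at 0 within {0..})"
    by (rule order_tendstoD)
  then obtain e where e: "e > 0" "\<And>t. t \<in> {0..} \<Longrightarrow> t \<noteq> 0 \<Longrightarrow> dist t 0 < e \<Longrightarrow> mittag_leffler \<alpha> (- (\<mu> * t powr \<alpha>)) > 0"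
    unfolding eventually_at by auto
  show ?thesis
    by (rule that[OF e(1)]) (use e(2) assms in \<open>auto simp: resolvent_kernel_def\<close>)
qed

lemma rl_kernel_conv_1:
  assumes "\<beta> > 0"
  shows "(rl_kernel \<beta> \<star> (\<lambda>_. 1)) t = rl_kernel (\<beta> + 1) t"
proof -
  have "(rl_kernel \<beta> \<star> (\<lambda>_. 1)) t = integral {0..t} (\<lambda>s. rl_kernel \<beta> (t - s) * 1)"
    unfolding causal_conv_def
    by (intro set_borel_integral_eq_integral causal_conv_integrable loc_int_rl_kernel assms) auto
  also have "\<dots> = integral {0..t} (\<lambda>s. rl_kernel \<beta> (t - s) * rl_kernel 1 s)"
    by (rule integral_spike[of "{0}"]) (auto simp: rl_kernel_def)
  also have "\<dots> = (rl_kernel \<beta> \<star> rl_kernel 1) t"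
    unfolding causal_conv_def
    using set_borel_integral_eq_integral(2)[OF rl_kernel_conv_integrable[OF assms, of 1 t]] by simp
  finally show ?thesis using rl_kernel_conv[OF assms, of 1] by simp
qed

lemma causal_conv_1: "(f \<star> (\<lambda>_. 1)) t = (LINT s:{0..t}|lborel. f s)"
  using fun_cong[OF causal_conv_commute[of f "\<lambda>_. 1"], of t] by (simp add: causal_conv_def)

text \<open>Cross-multiplied form of log-convexity: shifting both arguments back by \<open>s\<close>
  can only lower the ratio of the value at the later point \<open>r\<close> to that at the earlier
  point \<open>t\<close>. It reduces to \<open>(t - s) / (r - s) \<le> t / r\<close>, and the
  exponent \<open>\<alpha> - 1\<close> is negative.\<close>

lemma rl_kernel_ratio_le:
  assumes "0 < \<alpha>" "\<alpha> < 1" "0 \<le> s" "s < t" "t \<le> r"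
  shows "rl_kernel \<alpha> (r - s) * rl_kernel \<alpha> t \<le> rl_kernel \<alpha> r * rl_kernel \<alpha> (t - s)"
proof -
  have "r * (t - s) \<le> (r - s) * t"
    using mult_left_mono[OF assms(5,3)] by (simp add: algebra_simps)
  then have "((r - s) * t) powr (\<alpha> - 1) \<le> (r * (t - s)) powr (\<alpha> - 1)"
    using assms by (intro powr_mono2') auto
  then have "(r - s) powr (\<alpha> - 1) * t powr (\<alpha> - 1) \<le> r powr (\<alpha> - 1) * (t - s) powr (\<alpha> - 1)"
    using assms by (simp add: powr_mult)
  then show ?thesis
    using assms Gamma_real_pos[of \<alpha>] by (simp add: rl_kernel_def divide_right_mono)
qed

text \<open>Both factors can be singular, at opposite ends of the interval. The bound
  \<open>C * s powr (\<alpha> - 1)\<close> on the resolvent reduces the claim to two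
  Riemann-Liouville kernels.\<close>

lemma rl_kernel_conv_resolvent_integrable:
  assumes "\<alpha> > 0"
  shows "set_integrable lborel {0..t} (\<lambda>s. rl_kernel \<alpha> (t - s) * resolvent_kernel \<alpha> \<mu> s)"
proof -
  obtain C where C: "\<And>s. 0 \<le> s \<Longrightarrow> s \<le> t \<Longrightarrow> \<bar>resolvent_kernel \<alpha> \<mu> s\<bar> \<le> C * s powr (\<alpha> - 1)"
    using resolvent_kernel_abs_le[OF assms] by blast
  have G: "Gamma \<alpha> > 0" using assms Gamma_real_pos by blast
  have int: "set_integrable lborel {0..t} (\<lambda>s. (C * Gamma \<alpha>) * (rl_kernel \<alpha> (t - s) * rl_kernel \<alpha> s))"
    using rl_kernel_conv_integrable[OF assms assms, of t] by simp
  show ?thesis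
    unfolding set_integrable_def
  proof (rule Bochner_Integration.integrable_bound)
    show "integrable lborel (\<lambda>s. indicator {0..t} s *\<^sub>R ((C * Gamma \<alpha>) * (rl_kernel \<alpha> (t - s) * rl_kernel \<alpha> s)))"
      using int by (simp add: set_integrable_def)
    have "(\<lambda>s. indicator {0..t} s *\<^sub>R (rl_kernel \<alpha> (t - s) * resolvent_kernel \<alpha> \<mu> s)) =
        (\<lambda>s. (indicator {0..t} s *\<^sub>R rl_kernel \<alpha> (t - s)) * (indicator {0..t} s *\<^sub>R resolvent_kernel \<alpha> \<mu> s))"
      by (auto simp: indicator_def)
    then show "(\<lambda>s. indicator {0..t} s *\<^sub>R (rl_kernel \<alpha> (t - s) * resolvent_kernel \<alpha> \<mu> s)) \<in> borel_measurable lborel"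
      using loc_int_reflect[OF loc_int_rl_kernel[OF assms], of t] loc_intD[OF loc_int_resolvent_kernel[OF assms, of \<mu>], of t]
      unfolding set_integrable_def by simp
    show "AE s in lborel. norm (indicator {0..t} s *\<^sub>R (rl_kernel \<alpha> (t - s) * resolvent_kernel \<alpha> \<mu> s))
        \<le> norm (indicator {0..t} s *\<^sub>R ((C * Gamma \<alpha>) * (rl_kernel \<alpha> (t - s) * rl_kernel \<alpha> s)))"
    proof (rule AE_I2)
      fix s
      show "norm (indicator {0..t} s *\<^sub>R (rl_kernel \<alpha> (t - s) * resolvent_kernel \<alpha> \<mu> s))
        \<le> norm (indicator {0..t} s *\<^sub>R ((C * Gamma \<alpha>) * (rl_kernel \<alpha> (t - s) * rl_kernel \<alpha> s)))"
      proof (cases "s \<in> {0..t}")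
        case True
        have eq: "C * Gamma \<alpha> * rl_kernel \<alpha> s = C * s powr (\<alpha> - 1)"
          using True G by (simp add: rl_kernel_eq)
        have "\<bar>resolvent_kernel \<alpha> \<mu> s\<bar> \<le> \<bar>C * Gamma \<alpha> * rl_kernel \<alpha> s\<bar>"
          unfolding eq using C[of s] True by auto
        then have "\<bar>rl_kernel \<alpha> (t - s)\<bar> * \<bar>resolvent_kernel \<alpha> \<mu> s\<bar> \<le> \<bar>rl_kernel \<alpha> (t - s)\<bar> * \<bar>C * Gamma \<alpha> * rl_kernel \<alpha> s\<bar>"
          by (intro mult_left_mono) auto
        then show ?thesis using True by (simp add: abs_mult mult_ac)
      qed simp
    qed
  qed
qed

text \<open>
  Let \<open>z\<close> be the first zero of \<open>K\<close> and \<open>m\<close> a maximiser of \<open>K\<close> on a short interval \<open>[l, z]\<close>. Log-convexity gives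
  \<open>h(z - s) \<le> (h(z) / h(m)) h(m - s)\<close>, so comparing \<open>h \<star> K = h - K/\<mu>\<close> at \<open>m\<close> and at \<open>z\<close> bounds
  \<open>K(m) h(z) / (\<mu> h(m))\<close> by \<open>K(m) \<integral>\<^sub>0\<^sup>z\<^sup>-\<^sup>m h\<close>, which is too small if \<open>l\<close> is close to \<open>z\<close>.
\<close>
lemma resolvent_kernel_pos:
  assumes \<alpha>: "0 < \<alpha>" "\<alpha> < 1" and \<mu>: "\<mu> > 0" and "t > 0"
  shows "resolvent_kernel \<alpha> \<mu> t > 0"
proof (rule ccontr)
  define h K where "h = rl_kernel \<alpha>" and "K = resolvent_kernel \<alpha> \<mu>"
  assume "\<not> resolvent_kernel \<alpha> \<mu> t > 0"
  then have Kt: "K t \<le> 0" by (simp add: K_def)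
  have cont: "continuous_on {0<..} K"
    unfolding K_def by (rule continuous_resolvent_kernel[OF \<alpha>(1)])
  have hK: "(h \<star> K) r = h r - K r / \<mu>" for r
    unfolding h_def K_def by (simp add: rl_kernel_conv_resolvent[OF \<alpha>(1) \<mu>])
  have h_pos: "h r > 0" if "r > 0" for r
    unfolding h_def using \<alpha> that by (rule_tac rl_kernel_pos) auto
  have h_nonneg: "h r \<ge> 0" for r
    unfolding h_def using \<alpha> by (rule_tac rl_kernel_nonneg) auto
  obtain e where e: "e > 0" "\<And>r. 0 < r \<Longrightarrow> r < e \<Longrightarrow> K r > 0"
    unfolding K_def using resolvent_kernel_pos_near_0[OF \<alpha>(1) \<mu>] by blast
  have "e \<le> t" using e(2)[OF \<open>t > 0\<close>] Kt by linarith
  \<comment> \<open>Starting at \<open>e/2\<close> keeps \<open>Z\<close> inside the open half-line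
    where \<open>K\<close> is continuous; no zero is lost, as \<open>K\<close> is positive on
    \<open>(0, e)\<close>.\<close>
  define Z where "Z = {e/2..t} \<inter> K -` {..0}"
  have "closed Z"
    unfolding Z_def using e(1) by (intro continuous_closed_preimage continuous_on_subset[OF cont]) auto
  moreover have "bounded Z" unfolding Z_def by (rule bounded_subset[of "{e/2..t}"]) auto
  ultimately have "compact Z" by (simp add: compact_eq_bounded_closed)
  moreover have "t \<in> Z" using Kt \<open>e \<le> t\<close> e(1) by (simp add: Z_def)
  ultimately obtain z where z: "z \<in> Z" "\<And>r. r \<in> Z \<Longrightarrow> z \<le> r"
    using compact_attains_inf[of Z] by blast
  have z_pos: "z > 0" and Kz: "K z \<le> 0" using z(1) e(1) by (auto simp: Z_def)
  have K_pos: "K r > 0" if "0 < r" "r < z" for r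
  proof (cases "r < e")
    case False
    then show ?thesis using z(2)[of r] that z(1) e(1) by (force simp: Z_def)
  qed (use e(2) that in auto)
  \<comment> \<open>Chosen so that the mass of \<open>h\<close> on \<open>[0, d]\<close>, namely
    \<open>d powr \<alpha> / Gamma (\<alpha> + 1)\<close>, is \<open>1 / (4 * \<mu>)\<close>. This
    will force \<open>c \<le> 1/4\<close>.\<close>
  define d where "d = (Gamma (\<alpha> + 1) / (4 * \<mu>)) powr (1 / \<alpha>)"
  have G1: "Gamma (\<alpha> + 1) > 0" using \<alpha> by (intro Gamma_real_pos) auto
  have "x powr (1 / \<alpha>) > 0 \<and> (x powr (1 / \<alpha>)) powr \<alpha> = x" if "x > 0" for x :: real
    using \<alpha> that by (simp add: powr_powr)
  moreover have "Gamma (\<alpha> + 1) / (4 * \<mu>) > 0" using G1 \<mu> by (rule_tac divide_pos_pos) auto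
  ultimately have d: "d > 0" "d powr \<alpha> = Gamma (\<alpha> + 1) / (4 * \<mu>)"
    unfolding d_def by blast+
  \<comment> \<open>The bound \<open>z / 2\<close> keeps \<open>m / z \<ge> 1/2\<close>, hence
    \<open>c = (m / z) powr (1 - \<alpha>) \<ge> 1/2\<close>, which contradicts
    \<open>c \<le> 1/4\<close>.\<close>
  define l where "l = max (z / 2) (z - d)"
  have l: "0 < l" "l < z" "z / 2 \<le> l" "z - d \<le> l" using z_pos d(1) by (auto simp: l_def)
  have "continuous_on {l..z} K" using l by (intro continuous_on_subset[OF cont]) auto
  then obtain m where m: "m \<in> {l..z}" "\<And>r. r \<in> {l..z} \<Longrightarrow> K r \<le> K m"
    using continuous_attains_sup[of "{l..z}" K] l by fastforce
  have Km: "K m > 0" using K_pos[of l] m(2)[of l] l by force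
  then have m_less: "m < z" using Kz m(1) by (cases "m = z") auto
  have m_pos: "m > 0" using m(1) l by auto
  define c where "c = h z / h m"
  have ratio: "h (z - s) \<le> c * h (m - s)" if "0 \<le> s" "s < m" for s
    using rl_kernel_ratio_le[OF \<alpha> that, of z] m_less h_pos[OF m_pos]
    by (simp add: c_def h_def field_simps)
  have int: "set_integrable lborel {0..r} (\<lambda>s. h (r - s) * K s)" for r
    unfolding h_def K_def by (rule rl_kernel_conv_resolvent_integrable[OF \<alpha>(1)])
  have shift: "indicator {m..z} (m + 1 * u) *\<^sub>R h (z - (m + 1 * u)) = indicator {0..z - m} u *\<^sub>R (h (z - m - u) * 1)" for u
    by (auto simp: indicator_def algebra_simps)
  have h_tail_int: "set_integrable lborel {m..z} (\<lambda>s. h (z - s))"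
    unfolding set_integrable_def
    using causal_conv_integrable[OF loc_int_rl_kernel[OF \<alpha>(1), folded h_def], of "\<lambda>_. 1" "z - m"]
    by (subst lborel_integrable_real_affine_iff[where c=1 and t=m, symmetric])
      (simp_all only: shift set_integrable_def, auto)
  have h_tail: "(LINT s:{m..z}|lborel. h (z - s)) = rl_kernel (\<alpha> + 1) (z - m)"
    unfolding rl_kernel_conv_1[OF \<alpha>(1), symmetric] causal_conv_def set_lebesgue_integral_def
    by (subst lborel_integral_real_affine[where c=1 and t=m]) (simp_all only: shift h_def[symmetric], auto)
  have "(h \<star> K) z \<le> c * (h \<star> K) m + K m * (LINT s:{m..z}|lborel. h (z - s))"
  proof -
    have "(h \<star> K) z \<le> (LINT s|lborel. c * (indicator {0..m} s *\<^sub>R (h (m - s) * K s)) + K m * (indicator {m..z} s *\<^sub>R h (z - s)))"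
      unfolding causal_conv_def set_lebesgue_integral_def
    proof (rule integral_mono)
      show "integrable lborel (\<lambda>s. indicator {0..z} s *\<^sub>R (h (z - s) * K s))"
        using int[of z] by (simp add: set_integrable_def)
      show "integrable lborel (\<lambda>s. c * (indicator {0..m} s *\<^sub>R (h (m - s) * K s)) + K m * (indicator {m..z} s *\<^sub>R h (z - s)))"
        using int[of m] h_tail_int by (simp add: set_integrable_def)
      fix s
      have c: "c \<ge> 0" using h_nonneg by (simp add: c_def)
      consider "s < 0 \<or> s > z" | "s = 0" | "0 < s" "s < m" | "m \<le> s" "s \<le> z" using m_pos by linarith
      then show "indicator {0..z} s *\<^sub>R (h (z - s) * K s)
        \<le> c * (indicator {0..m} s *\<^sub>R (h (m - s) * K s)) + K m * (indicator {m..z} s *\<^sub>R h (z - s))"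
      proof cases
        case 1
        then show ?thesis using m_less m_pos by auto
      next
        case 2
        then show ?thesis using m_pos m_less by (simp add: K_def resolvent_kernel_def)
      next
        case 3
        then have "h (z - s) * K s \<le> (c * h (m - s)) * K s"
          using K_pos[of s] m_less ratio[of s] by (intro mult_right_mono) auto
        then show ?thesis using 3 m_less by (simp add: mult.assoc)
      next
        case 4
        then have "h (z - s) * K s \<le> h (z - s) * K m"
          using m h_nonneg by (intro mult_left_mono) auto
        moreover have "h (m - s) = 0" using 4 by (simp add: h_def rl_kernel_def)
        ultimately show ?thesis using 4 m_pos by (simp add: mult.commute)
      qed
    qed
    also have "\<dots> = c * (h \<star> K) m + K m * (LINT s:{m..z}|lborel. h (z - s))"
      unfolding causal_conv_def set_lebesgue_integral_def
      using int[of m] h_tail_int by (subst Bochner_Integration.integral_add) (auto simp: set_integrable_def)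
    finally show ?thesis .
  qed
  \<comment> \<open>At \<open>z\<close> the resolvent equation gives
    \<open>(h \<star> K) z \<ge> h z\<close> because \<open>K z \<le> 0\<close>; at \<open>m\<close>
    it is used as an equality, whose term \<open>K m / \<mu>\<close> is the gain.\<close>
  then have "h z \<le> c * (h m - K m / \<mu>) + K m * rl_kernel (\<alpha> + 1) (z - m)"
    using Kz \<mu> unfolding hK h_tail by (smt (verit) divide_nonpos_pos)
  moreover have "c * h m = h z" using h_pos[OF m_pos] by (simp add: c_def)
  ultimately have "K m * (c / \<mu>) \<le> K m * rl_kernel (\<alpha> + 1) (z - m)"
    by (simp add: right_diff_distrib mult.commute)
  then have "c / \<mu> \<le> rl_kernel (\<alpha> + 1) (z - m)"
    using Km by (rule mult_left_le_imp_le)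
  also have "\<dots> \<le> d powr \<alpha> / Gamma (\<alpha> + 1)"
    unfolding rl_kernel_def using m_less m(1) l \<alpha> G1 by (auto intro!: divide_right_mono powr_mono2)
  also have "\<dots> = 1 / (4 * \<mu>)" using G1 by (simp add: d(2))
  finally have "c \<le> 1/4" using \<mu> by (simp add: field_simps)
  moreover have "c \<ge> 1/2"
  proof -
    have "c = (m / z) powr (1 - \<alpha>)"
      using m_pos z_pos Gamma_real_pos[OF \<alpha>(1)] powr_minus_divide[of "m / z" "\<alpha> - 1"]
      by (simp add: c_def h_def rl_kernel_def powr_divide)
    also have "\<dots> \<ge> (m / z) powr 1"
      using m_pos m_less z_pos \<alpha> by (intro powr_mono') auto
    also have "(m / z) powr 1 = m / z" using m_pos z_pos by simp
    also have "m / z \<ge> 1/2" using m(1) l z_pos by (simp add: field_simps)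
    finally show ?thesis by simp
  qed
  ultimately show False by simp
qed

lemma resolvent_kernel_nonneg:
  assumes "0 < \<alpha>" "\<alpha> < 1" "\<mu> > 0"
  shows "resolvent_kernel \<alpha> \<mu> t \<ge> 0"
  using resolvent_kernel_pos[OF assms, of t] by (cases "t > 0") (auto simp: resolvent_kernel_def)

section \<open>The total mass of the resolvent kernel\<close>

definition resolvent_mass :: "real \<Rightarrow> real \<Rightarrow> real \<Rightarrow> real"
  where "resolvent_mass \<alpha> \<mu> = resolvent_kernel \<alpha> \<mu> \<star> (\<lambda>_. 1)"

lemma continuous_resolvent_mass:
  "\<alpha> > 0 \<Longrightarrow> continuous_on {0..} (resolvent_mass \<alpha> \<mu>)"
  unfolding resolvent_mass_def
  by (intro continuous_causal_conv loc_int_resolvent_kernel) auto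

lemma resolvent_mass_mono:
  assumes "0 < \<alpha>" "\<alpha> < 1" "\<mu> > 0" "s \<le> t"
  shows "resolvent_mass \<alpha> \<mu> s \<le> resolvent_mass \<alpha> \<mu> t"
  unfolding resolvent_mass_def causal_conv_1 set_lebesgue_integral_def
proof (rule integral_mono)
  show "integrable lborel (\<lambda>r. indicator {0..s} r *\<^sub>R resolvent_kernel \<alpha> \<mu> r)"
    "integrable lborel (\<lambda>r. indicator {0..t} r *\<^sub>R resolvent_kernel \<alpha> \<mu> r)"
    using loc_intD[OF loc_int_resolvent_kernel[OF assms(1)]] unfolding set_integrable_def by blast+
  show "indicator {0..s} r *\<^sub>R resolvent_kernel \<alpha> \<mu> r \<le> indicator {0..t} r *\<^sub>R resolvent_kernel \<alpha> \<mu> r" for r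
    using assms(4) resolvent_kernel_nonneg[OF assms(1-3), of r] by (auto simp: indicator_def)
qed

lemma resolvent_mass_nonpos: "t \<le> 0 \<Longrightarrow> resolvent_mass \<alpha> \<mu> t = 0"
  by (simp add: resolvent_mass_def causal_conv_nonpos)

lemma resolvent_mass_nonneg:
  assumes "0 < \<alpha>" "\<alpha> < 1" "\<mu> > 0"
  shows "resolvent_mass \<alpha> \<mu> t \<ge> 0"
  using resolvent_mass_mono[OF assms, of "min 0 t" t] by (simp add: resolvent_mass_nonpos)

text \<open>The resolvent equation convolved with the constant 1. It says that
  \<open>1 - resolvent_mass \<alpha> \<mu>\<close> solves the fractional relaxation equation with
  rate \<open>\<mu>\<close> and initial value 1, that is, equals the one-parameter function
  \<open>E_\<alpha>(-\<mu> t^\<alpha>)\<close>.\<close>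

lemma resolvent_mass_eq:
  assumes "\<alpha> > 0" "\<mu> > 0"
  shows "resolvent_mass \<alpha> \<mu> = (\<lambda>t. \<mu> * (rl_kernel \<alpha> \<star> (\<lambda>s. 1 - resolvent_mass \<alpha> \<mu> s)) t)"
proof
  fix t
  have "(rl_kernel \<alpha> \<star> resolvent_mass \<alpha> \<mu>) t = ((rl_kernel \<alpha> \<star> resolvent_kernel \<alpha> \<mu>) \<star> (\<lambda>_. 1)) t"
    unfolding resolvent_mass_def
    by (subst causal_conv_assoc) (auto intro!: loc_int_rl_kernel loc_int_resolvent_kernel assms)
  also have "\<dots> = (rl_kernel \<alpha> \<star> (\<lambda>_. 1)) t - resolvent_mass \<alpha> \<mu> t / \<mu>"
    unfolding rl_kernel_conv_resolvent[OF assms] resolvent_mass_def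
    by (subst causal_conv_add_left) (auto intro!: loc_int_rl_kernel loc_int_resolvent_kernel assms)
  finally have "(rl_kernel \<alpha> \<star> (\<lambda>s. 1 - resolvent_mass \<alpha> \<mu> s)) t = resolvent_mass \<alpha> \<mu> t / \<mu>"
    by (subst causal_conv_diff) (auto intro!: loc_int_rl_kernel continuous_resolvent_mass assms)
  then show "resolvent_mass \<alpha> \<mu> t = \<mu> * (rl_kernel \<alpha> \<star> (\<lambda>s. 1 - resolvent_mass \<alpha> \<mu> s)) t"
    using assms by simp
qed

text \<open>Convolving \<open>V = \<mu> (rl_kernel \<alpha> \<star> E)\<close> with the
  complementary kernel \<open>rl_kernel (1 - \<alpha>)\<close> turns the right side into
  \<open>\<mu>\<close> times the plain integral of \<open>E = 1 - V\<close>, which is therefore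
  nonnegative. If \<open>V\<close> ever exceeded 1, monotonicity would keep \<open>E\<close> below a
  negative constant from then on.\<close>

lemma resolvent_mass_le_1:
  assumes \<alpha>: "0 < \<alpha>" "\<alpha> < 1" and \<mu>: "\<mu> > 0"
  shows "resolvent_mass \<alpha> \<mu> t \<le> 1"
proof (rule ccontr)
  define V E where "V = resolvent_mass \<alpha> \<mu>" and "E = (\<lambda>t. 1 - V t)"
  have V: "continuous_on {0..} V" unfolding V_def by (rule continuous_resolvent_mass[OF \<alpha>(1)])
  have E: "continuous_on {0..} E" unfolding E_def by (intro continuous_intros V)
  assume "\<not> resolvent_mass \<alpha> \<mu> t \<le> 1"
  then have Vt: "V t > 1" by (simp add: V_def)
  then have t: "t > 0" using resolvent_mass_nonpos[of t \<alpha> \<mu>] by (force simp: V_def)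
  \<comment> \<open>With this \<open>r\<close> the upper bound \<open>t - e * (r - t)\<close> for
    the integral of \<open>E\<close> equals \<open>-e\<close>.\<close>
  define e r where "e = V t - 1" and "r = t + t / e + 1"
  have e: "e > 0" and r: "t < r" using Vt t by (auto simp: e_def r_def add_pos_pos)
  have "0 \<le> (rl_kernel (1 - \<alpha>) \<star> V) r"
  proof -
    have "(rl_kernel (1 - \<alpha>) \<star> (\<lambda>_. 0)) r \<le> (rl_kernel (1 - \<alpha>) \<star> V) r"
      using \<alpha> resolvent_mass_nonneg[OF \<alpha> \<mu>]
      by (intro causal_conv_mono loc_int_rl_kernel rl_kernel_nonneg V) (auto simp: V_def)
    then show ?thesis by (simp add: causal_conv_def)
  qed
  also have "(rl_kernel (1 - \<alpha>) \<star> V) r = \<mu> * (rl_kernel (1 - \<alpha>) \<star> (rl_kernel \<alpha> \<star> E)) r"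
  proof -
    have "V = (\<lambda>s. \<mu> * (rl_kernel \<alpha> \<star> E) s)"
      unfolding E_def V_def by (rule resolvent_mass_eq[OF \<alpha>(1) \<mu>])
    then have "(rl_kernel (1 - \<alpha>) \<star> V) r = (rl_kernel (1 - \<alpha>) \<star> (\<lambda>s. \<mu> * (rl_kernel \<alpha> \<star> E) s)) r"
      by (rule arg_cong)
    then show ?thesis by (simp only: causal_conv_cmult)
  qed
  also have "rl_kernel (1 - \<alpha>) \<star> (rl_kernel \<alpha> \<star> E) = rl_kernel 1 \<star> E"
    using \<alpha> E by (simp add: causal_conv_assoc loc_int_rl_kernel rl_kernel_conv)
  also have "(rl_kernel 1 \<star> E) r = integral {0..r} E"
    by (rule rl_kernel_1_conv[OF E])
  finally have "0 \<le> integral {0..r} E" using \<mu> by (simp add: zero_le_mult_iff)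
  also have "integral {0..r} E = integral {0..t} E + integral {t..r} E"
    using t r by (intro Henstock_Kurzweil_Integration.integral_combine[symmetric] integrable_continuous_interval continuous_on_subset[OF E]) auto
  also have "integral {0..t} E \<le> integral {0..t} (\<lambda>_. 1)"
    using resolvent_mass_nonneg[OF \<alpha> \<mu>]
    by (intro integral_le integrable_continuous_interval continuous_on_subset[OF E]) (auto simp: E_def V_def)
  also have "integral {t..r} E \<le> integral {t..r} (\<lambda>_. - e)"
    using t resolvent_mass_mono[OF \<alpha> \<mu>, of t]
    by (intro integral_le integrable_continuous_interval continuous_on_subset[OF E]) (auto simp: E_def V_def e_def)
  also have "integral {0..t} (\<lambda>_. 1) + integral {t..r} (\<lambda>_. - e) = t - e * (r - t)"
    using t r by simp
  also have "\<dots> < 0" using e by (simp add: r_def field_simps)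
  finally show False by simp
qed

text \<open>As \<open>1 - V\<close> is decreasing, its value at \<open>t\<close> times the mass
  \<open>t powr \<alpha> / Gamma (\<alpha> + 1)\<close> of \<open>rl_kernel \<alpha>\<close> is at
  most \<open>V t / \<mu> \<le> 1 / \<mu>\<close>. The rate obtained is algebraic,
  \<open>t powr (- \<alpha>)\<close>.\<close>

lemma resolvent_mass_tendsto_1:
  assumes \<alpha>: "0 < \<alpha>" "\<alpha> < 1" and \<mu>: "\<mu> > 0"
  shows "(resolvent_mass \<alpha> \<mu> \<longlongrightarrow> 1) at_top"
proof (rule tendsto_sandwich)
  define V where "V = resolvent_mass \<alpha> \<mu>"
  have G: "Gamma (\<alpha> + 1) > 0" using \<alpha> by (intro Gamma_real_pos) auto
  have V: "continuous_on {0..} V" unfolding V_def by (rule continuous_resolvent_mass[OF \<alpha>(1)])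
  have "1 - Gamma (\<alpha> + 1) / \<mu> * t powr (- \<alpha>) \<le> V t" if t: "t > 0" for t
  proof -
    have "(1 - V t) * (rl_kernel \<alpha> \<star> (\<lambda>_. 1)) t = (rl_kernel \<alpha> \<star> (\<lambda>_. (1 - V t) * 1)) t"
      by (rule causal_conv_cmult[symmetric])
    also have "\<dots> \<le> (rl_kernel \<alpha> \<star> (\<lambda>s. 1 - V s)) t"
      using \<alpha> resolvent_mass_mono[OF \<alpha> \<mu>, of _ t]
      by (intro causal_conv_mono loc_int_rl_kernel rl_kernel_nonneg continuous_intros V) (auto simp: V_def)
    finally have "\<mu> * ((1 - V t) * (rl_kernel \<alpha> \<star> (\<lambda>_. 1)) t) \<le> \<mu> * (rl_kernel \<alpha> \<star> (\<lambda>s. 1 - V s)) t"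
      using \<mu> by simp
    also have "\<dots> = V t"
      using fun_cong[OF resolvent_mass_eq[OF \<alpha>(1) \<mu>], of t] by (simp add: V_def)
    also have "V t \<le> 1" unfolding V_def by (rule resolvent_mass_le_1[OF assms])
    finally have "\<mu> * ((1 - V t) * (t powr \<alpha> / Gamma (\<alpha> + 1))) \<le> 1"
      using t by (simp add: rl_kernel_conv_1[OF \<alpha>(1)] rl_kernel_def)
    then have "1 - V t \<le> Gamma (\<alpha> + 1) / (\<mu> * t powr \<alpha>)"
      using G \<mu> t by (simp add: field_simps)
    then show ?thesis by (simp add: powr_minus_divide)
  qed
  then show "eventually (\<lambda>t. 1 - Gamma (\<alpha> + 1) / \<mu> * t powr (- \<alpha>) \<le> resolvent_mass \<alpha> \<mu> t) at_top"
    unfolding V_def by (rule eventually_mono[OF eventually_gt_at_top])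
  show "eventually (\<lambda>t. resolvent_mass \<alpha> \<mu> t \<le> 1) at_top"
    using resolvent_mass_le_1[OF assms] by simp
  have "((\<lambda>t. t powr (- \<alpha>)) \<longlongrightarrow> 0) at_top"
    using \<alpha> by (intro tendsto_neg_powr filterlim_ident) auto
  then have "((\<lambda>t. 1 - Gamma (\<alpha> + 1) / \<mu> * t powr (- \<alpha>)) \<longlongrightarrow> 1 - Gamma (\<alpha> + 1) / \<mu> * 0) at_top"
    by (intro tendsto_intros)
  then show "((\<lambda>t. 1 - Gamma (\<alpha> + 1) / \<mu> * t powr (- \<alpha>)) \<longlongrightarrow> 1) at_top" by simp
qed simp

section \<open>Variation of constants and delayed convolutions\<close>

lemma caputo_prim_eq_conv:
  assumes "\<alpha> < 1" "continuous_on {0..} x"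
  shows "caputo_prim \<alpha> x t = (rl_kernel (1 - \<alpha>) \<star> (\<lambda>s. x s - x 0)) t"
proof -
  have "(rl_kernel (1 - \<alpha>) \<star> (\<lambda>s. x s - x 0)) t = integral {0..t} (\<lambda>s. rl_kernel (1 - \<alpha>) (t - s) * (x s - x 0))"
    unfolding causal_conv_def using assms
    by (intro set_borel_integral_eq_integral causal_conv_integrable loc_int_rl_kernel continuous_intros) auto
  also have "\<dots> = integral {0..t} (\<lambda>s. ((t - s) powr (-\<alpha>) * (x s - x 0)) / Gamma (1 - \<alpha>))"
    by (rule Henstock_Kurzweil_Integration.integral_cong) (auto simp: rl_kernel_eq)
  finally show ?thesis by (simp add: caputo_prim_def)
qed

lemma integral_eq_imp_eq:
  fixes u w :: "real \<Rightarrow> real"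
  assumes "continuous_on {0..} u" "continuous_on {0..} w" "T > 0"
    and eq: "\<And>r. r \<in> {0..T} \<Longrightarrow> integral {0..r} u = integral {0..r} w" and t: "t \<in> {0..T}"
  shows "u t = w t"
proof -
  have "((\<lambda>r. integral {0..r} u) has_vector_derivative u t) (at t within {0..T})"
    using t by (intro integral_has_vector_derivative continuous_on_subset[OF assms(1)]) auto
  moreover have "((\<lambda>r. integral {0..r} w) has_vector_derivative w t) (at t within {0..T})"
    using t by (intro integral_has_vector_derivative continuous_on_subset[OF assms(2)]) auto
  then have "((\<lambda>r. integral {0..r} u) has_vector_derivative w t) (at t within {0..T})"
    by (rule has_vector_derivative_transform[OF t, rotated]) (simp add: eq)
  ultimately show ?thesis
    using vector_derivative_unique_within_closed_interval[of 0 T t] assms(3) t by auto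
qed

text \<open>\<open>rl_kernel \<alpha>\<close> and \<open>rl_kernel (1 - \<alpha>)\<close> convolve
  to ordinary integration, so each direction convolves with the missing kernel. From left to right
  this gives equal primitives of \<open>x - x 0\<close> and
  \<open>rl_kernel \<alpha> \<star> F\<close>, and only these continuous functions are recovered by
  differentiation. The equivalence is kept on each finite \<open>[0, T]\<close> for the later
  localisation.\<close>

lemma caputo_prim_iff_volterra:
  assumes \<alpha>: "0 < \<alpha>" "\<alpha> < 1" and x: "continuous_on {0..} x" and F: "continuous_on {0..} F" and "T > 0"
  shows "(\<forall>t\<in>{0..T}. caputo_prim \<alpha> x t = integral {0..t} F) \<longleftrightarrow>
         (\<forall>t\<in>{0..T}. x t = x 0 + (rl_kernel \<alpha> \<star> F) t)"
proof
  define y where "y = (\<lambda>s. x s - x 0)"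
  define h k where "h = rl_kernel \<alpha>" and "k = rl_kernel (1 - \<alpha>)"
  have y: "continuous_on {0..} y" unfolding y_def by (intro continuous_intros x)
  have cp: "caputo_prim \<alpha> x t = (k \<star> y) t" for t
    unfolding k_def y_def by (rule caputo_prim_eq_conv[OF \<alpha>(2) x])
  have li: "loc_int h" "loc_int k" "loc_int (rl_kernel 1)"
    unfolding h_def k_def using \<alpha> by (auto intro: loc_int_rl_kernel)
  have hk: "h \<star> k = rl_kernel 1" "k \<star> h = rl_kernel 1"
    unfolding h_def k_def using \<alpha> by (simp_all add: rl_kernel_conv)
  have hF: "continuous_on {0..} (h \<star> F)" by (rule continuous_causal_conv[OF li(1) F])
  note int1 = rl_kernel_1_conv
  {
    assume eq: "\<forall>t\<in>{0..T}. caputo_prim \<alpha> x t = integral {0..t} F"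
    have "integral {0..r} y = integral {0..r} (h \<star> F)" if r: "r \<in> {0..T}" for r
    proof -
      have "integral {0..r} y = (h \<star> (k \<star> y)) r"
        using causal_conv_assoc[OF li(1,2) y] by (simp add: hk int1[OF y])
      also have "\<dots> = (h \<star> (rl_kernel 1 \<star> F)) r"
        by (rule causal_conv_cong) (use eq r in \<open>auto simp: cp int1[OF F]\<close>)
      also have "\<dots> = (rl_kernel 1 \<star> (h \<star> F)) r"
        using causal_conv_assoc[OF li(1,3) F] causal_conv_assoc[OF li(3,1) F]
        by (simp add: causal_conv_commute[of h "rl_kernel 1"])
      also have "\<dots> = integral {0..r} (h \<star> F)" by (rule int1[OF hF])
      finally show ?thesis .
    qed
    then have "y t = (h \<star> F) t" if "t \<in> {0..T}" for t
      using integral_eq_imp_eq[OF y hF \<open>T > 0\<close> _ that] by blast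
    moreover have "x t = x 0 + y t" for t by (simp add: y_def)
    ultimately show "\<forall>t\<in>{0..T}. x t = x 0 + (rl_kernel \<alpha> \<star> F) t"
      unfolding h_def by metis
  next
    assume eq: "\<forall>t\<in>{0..T}. x t = x 0 + (rl_kernel \<alpha> \<star> F) t"
    show "\<forall>t\<in>{0..T}. caputo_prim \<alpha> x t = integral {0..t} F"
    proof
      fix t assume t: "t \<in> {0..T}"
      have "y s = (h \<star> F) s" if "0 \<le> s" "s \<le> t" for s
        using bspec[OF eq, of s] t that unfolding y_def h_def by simp
      then have "caputo_prim \<alpha> x t = (k \<star> (h \<star> F)) t"
        unfolding cp by (rule causal_conv_cong[OF refl])
      also have "\<dots> = integral {0..t} F"
        using causal_conv_assoc[OF li(2,1) F] by (simp add: hk int1[OF F])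
      finally show "caputo_prim \<alpha> x t = integral {0..t} F" .
    qed
  }
qed

text \<open>One direction convolves the equation with the resolvent kernel, the other with
  \<open>rl_kernel \<alpha>\<close>; the resolvent equation eliminates the double convolution.
  \<open>G\<close> is any continuous function and may itself depend on \<open>x\<close>, so this is
  a reformulation rather than a solution formula.\<close>

lemma volterra_iff_resolvent:
  assumes \<alpha>: "0 < \<alpha>" and \<mu>: "\<mu> > 0" and x: "continuous_on {0..} x" and G: "continuous_on {0..} G"
  shows "(\<forall>t\<in>{0..T}. x t = c + (rl_kernel \<alpha> \<star> (\<lambda>s. G s - \<mu> * x s)) t) \<longleftrightarrow>
         (\<forall>t\<in>{0..T}. x t = c * (1 - resolvent_mass \<alpha> \<mu> t) + (1/\<mu>) * (resolvent_kernel \<alpha> \<mu> \<star> G) t)"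
proof
  define h K V W where "h = rl_kernel \<alpha>" and "K = resolvent_kernel \<alpha> \<mu>" and "V = resolvent_mass \<alpha> \<mu>"
    and "W = (\<lambda>s. G s - \<mu> * x s)"
  have W: "continuous_on {0..} W" unfolding W_def by (intro continuous_intros x G)
  have li: "loc_int h" "loc_int K"
    unfolding h_def K_def using \<alpha> by (auto intro: loc_int_rl_kernel loc_int_resolvent_kernel)
  have V: "continuous_on {0..} V" unfolding V_def by (rule continuous_resolvent_mass[OF \<alpha>])
  have hW: "continuous_on {0..} (h \<star> W)" by (rule continuous_causal_conv[OF li(1) W])
  have KG: "continuous_on {0..} (K \<star> G)" by (rule continuous_causal_conv[OF li(2) G])
  have hKw: "(h \<star> (K \<star> w)) t = (h \<star> w) t - (1/\<mu>) * (K \<star> w) t" if w: "continuous_on {0..} w" for w t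
  proof -
    have "h \<star> (K \<star> w) = (\<lambda>t. h t + (- (1/\<mu>)) * K t) \<star> w"
      unfolding causal_conv_assoc[OF li w] unfolding h_def K_def rl_kernel_conv_resolvent[OF \<alpha> \<mu>] ..
    then show ?thesis by (simp only: causal_conv_add_left[OF li w])
  qed
  have Khw: "K \<star> (h \<star> w) = h \<star> (K \<star> w)" if w: "continuous_on {0..} w" for w
    using causal_conv_assoc[OF li w] causal_conv_assoc[OF li(2,1) w] by (simp add: causal_conv_commute[of h K])
  {
    assume eq: "\<forall>t\<in>{0..T}. x t = c + (rl_kernel \<alpha> \<star> (\<lambda>s. G s - \<mu> * x s)) t"
    show "\<forall>t\<in>{0..T}. x t = c * (1 - resolvent_mass \<alpha> \<mu> t) + (1/\<mu>) * (resolvent_kernel \<alpha> \<mu> \<star> G) t"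
    proof
      fix t assume t: "t \<in> {0..T}"
      have "(K \<star> x) t = (K \<star> (\<lambda>s. c * 1 + (h \<star> W) s)) t"
        using eq t by (intro causal_conv_cong) (auto simp: h_def W_def)
      also have "\<dots> = (K \<star> (\<lambda>s. c * 1)) t + (K \<star> (h \<star> W)) t"
        by (intro causal_conv_add li hW) auto
      also have "(K \<star> (\<lambda>s. c * 1)) t = c * V t"
        unfolding causal_conv_cmult by (simp add: V_def K_def resolvent_mass_def)
      also have "(K \<star> (h \<star> W)) t = (h \<star> W) t - (1/\<mu>) * (K \<star> W) t"
        by (simp add: Khw[OF W] hKw[OF W])
      also have "(K \<star> W) t = (K \<star> G) t - \<mu> * (K \<star> x) t"
        unfolding W_def causal_conv_cmult[symmetric] by (intro causal_conv_diff li G continuous_intros x)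
      \<comment> \<open>\<open>(K \<star> x) t\<close> stands at both ends of the chain with
        coefficient 1 and cancels.\<close>
      finally have "(h \<star> W) t = (1/\<mu>) * (K \<star> G) t - c * V t"
        using \<mu> by (simp add: right_diff_distrib)
      then show "x t = c * (1 - resolvent_mass \<alpha> \<mu> t) + (1/\<mu>) * (resolvent_kernel \<alpha> \<mu> \<star> G) t"
        using eq t by (simp add: h_def W_def V_def K_def right_diff_distrib)
    qed
  next
    assume eq: "\<forall>t\<in>{0..T}. x t = c * (1 - resolvent_mass \<alpha> \<mu> t) + (1/\<mu>) * (resolvent_kernel \<alpha> \<mu> \<star> G) t"
    show "\<forall>t\<in>{0..T}. x t = c + (rl_kernel \<alpha> \<star> (\<lambda>s. G s - \<mu> * x s)) t"
    proof
      fix t assume t: "t \<in> {0..T}"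
      have "(h \<star> x) t = (h \<star> (\<lambda>s. c * (1 - V s) + (1/\<mu>) * (K \<star> G) s)) t"
        using eq t by (intro causal_conv_cong) (auto simp: V_def K_def)
      also have "\<dots> = (h \<star> (\<lambda>s. c * (1 - V s))) t + (h \<star> (\<lambda>s. (1/\<mu>) * (K \<star> G) s)) t"
        by (intro causal_conv_add li continuous_intros V KG)
      also have "(h \<star> (\<lambda>s. c * (1 - V s))) t = c * (V t / \<mu>)"
        using fun_cong[OF resolvent_mass_eq[OF \<alpha> \<mu>], of t] \<mu> by (simp add: causal_conv_cmult V_def h_def)
      also have "(h \<star> (\<lambda>s. (1/\<mu>) * (K \<star> G) s)) t = (1/\<mu>) * ((h \<star> G) t - (1/\<mu>) * (K \<star> G) t)"
        unfolding causal_conv_cmult by (simp only: hKw[OF G])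
      finally have hx: "\<mu> * (h \<star> x) t = c * V t + (h \<star> G) t - (1/\<mu>) * (K \<star> G) t"
        using \<mu> by (simp add: field_simps)
      have "(h \<star> W) t = (h \<star> G) t - \<mu> * (h \<star> x) t"
        unfolding W_def causal_conv_cmult[symmetric] by (intro causal_conv_diff li G continuous_intros x)
      then have "(h \<star> W) t = (1/\<mu>) * (K \<star> G) t - c * V t" by (simp add: hx)
      then show "x t = c + (rl_kernel \<alpha> \<star> (\<lambda>s. G s - \<mu> * x s)) t"
        using eq t by (simp add: h_def W_def V_def K_def right_diff_distrib)
    qed
  }
qed

section \<open>Delays moved from the function into the kernel\<close>

lemma indicator_shift:
  fixes k :: "real \<Rightarrow> real"
  assumes "\<And>t. t \<le> 0 \<Longrightarrow> k t = 0" "\<tau> \<ge> 0"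
  shows "indicator {0..T} (\<tau> + 1 * u) *\<^sub>R k (\<tau> + 1 * u - \<tau>) = indicator {0..T - \<tau>} u *\<^sub>R k u"
  using assms by (cases "u \<le> 0") (auto simp: indicator_def)

lemma loc_int_shift:
  assumes "loc_int k" "\<And>t. t \<le> 0 \<Longrightarrow> k t = 0" "\<tau> \<ge> 0"
  shows "loc_int (\<lambda>u. k (u - \<tau>))"
  unfolding loc_int_def set_integrable_def
proof
  fix T
  show "integrable lborel (\<lambda>u. indicator {0..T} u *\<^sub>R k (u - \<tau>))"
    using loc_intD[OF assms(1), of "T - \<tau>"] unfolding set_integrable_def
    by (subst lborel_integrable_real_affine_iff[where c=1 and t=\<tau>, symmetric])
      (simp_all only: indicator_shift[of k \<tau>, OF assms(2,3)] one_neq_zero not_False_eq_True)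
qed

lemma shift_conv_1:
  assumes "\<And>t. t \<le> 0 \<Longrightarrow> k t = 0" "\<tau> \<ge> 0"
  shows "((\<lambda>u. k (u - \<tau>)) \<star> (\<lambda>_. 1)) t = (k \<star> (\<lambda>_. 1)) (t - \<tau>)"
  unfolding causal_conv_1 set_lebesgue_integral_def
  by (subst lborel_integral_real_affine[where c=1 and t=\<tau>])
    (simp_all only: indicator_shift[of k \<tau>, OF assms] one_neq_zero not_False_eq_True abs_one scaleR_one)

text \<open>Substituting \<open>s - \<tau>\<close> moves the delay onto the kernel. What is left
  over is the range \<open>s < \<tau>\<close>, where \<open>x (s - \<tau>)\<close> reads only the
  history. Times \<open>t < \<tau>\<close> need no separate case because \<open>k\<close> vanishes
  on nonpositive arguments.\<close>

lemma
  assumes k: "loc_int k" "\<And>t. t \<le> 0 \<Longrightarrow> k t = 0" and \<tau>: "\<tau> \<ge> 0" and x: "continuous_on {-\<tau>..} x"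
  shows delay_conv_integrable: "set_integrable lborel {0..<\<tau>} (\<lambda>s. k (t - s) * x (s - \<tau>))"
    and delay_conv: "(k \<star> (\<lambda>s. x (s - \<tau>))) t =
      ((\<lambda>u. k (u - \<tau>)) \<star> x) t + (LINT s:{0..<\<tau>}|lborel. k (t - s) * x (s - \<tau>))"
proof -
  define A where "A = (\<lambda>s. indicator {0..t} s *\<^sub>R (k (t - s) * x (s - \<tau>)))"
  define B where "B = (\<lambda>s. indicator {0..t} s *\<^sub>R (k (t - s - \<tau>) * x s))"
  have x': "continuous_on {0..} (\<lambda>s. x (s - \<tau>))"
    by (rule continuous_on_compose2[OF x]) (auto intro!: continuous_intros)
  have x0: "continuous_on {0..} x" using \<tau> by (intro continuous_on_subset[OF x]) auto
  have A: "integrable lborel A"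
    using causal_conv_integrable[OF k(1) x', of t] by (simp add: A_def set_integrable_def)
  have B: "integrable lborel B"
    using causal_conv_integrable[OF loc_int_shift[OF k \<tau>] x0, of t] by (simp add: B_def set_integrable_def)
  have B': "integrable lborel (\<lambda>s. B (-\<tau> + 1 * s))"
    using B by (subst lborel_integrable_real_affine_iff) auto
  have eq: "indicator {0..<\<tau>} s *\<^sub>R (k (t - s) * x (s - \<tau>)) = A s - B (-\<tau> + 1 * s)" for s
  proof -
    have "t - s \<le> 0 \<Longrightarrow> k (t - s) = 0" by (rule k(2))
    then show ?thesis
      using \<tau> unfolding A_def B_def by (cases "t - s \<le> 0") (auto simp: indicator_def algebra_simps)
  qed
  show "set_integrable lborel {0..<\<tau>} (\<lambda>s. k (t - s) * x (s - \<tau>))"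
    unfolding set_integrable_def eq by (rule Bochner_Integration.integrable_diff[OF A B'])
  have "(LINT s:{0..<\<tau>}|lborel. k (t - s) * x (s - \<tau>)) = integral\<^sup>L lborel A - (LINT s|lborel. B (-\<tau> + 1 * s))"
    unfolding set_lebesgue_integral_def eq by (rule Bochner_Integration.integral_diff[OF A B'])
  also have "(LINT s|lborel. B (-\<tau> + 1 * s)) = integral\<^sup>L lborel B"
    using lborel_integral_real_affine[of 1 B "-\<tau>"] by simp
  finally show "(k \<star> (\<lambda>s. x (s - \<tau>))) t =
      ((\<lambda>u. k (u - \<tau>)) \<star> x) t + (LINT s:{0..<\<tau>}|lborel. k (t - s) * x (s - \<tau>))"
    by (simp add: causal_conv_def A_def B_def set_lebesgue_integral_def)
qed

text \<open>The history is weighted by the part of \<open>\<bar>k\<bar>\<close> on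
  \<open>[t - \<tau>, t]\<close>. This bound is at once uniform in \<open>t\<close> and, when the
  mass of \<open>k\<close> converges, vanishing for large \<open>t\<close>.\<close>

lemma delay_conv_diff_le:
  assumes k: "loc_int k" "\<And>t. t \<le> 0 \<Longrightarrow> k t = 0" and \<tau>: "\<tau> \<ge> 0" and x: "continuous_on {-\<tau>..} x"
    and \<delta>: "\<And>s. -\<tau> \<le> s \<Longrightarrow> s \<le> 0 \<Longrightarrow> \<bar>x s\<bar> \<le> \<delta>"
  shows "\<bar>(k \<star> (\<lambda>s. x (s - \<tau>))) t - ((\<lambda>u. k (u - \<tau>)) \<star> x) t\<bar> \<le>
    \<delta> * (((\<lambda>u. \<bar>k u\<bar>) \<star> (\<lambda>_. 1)) t - ((\<lambda>u. \<bar>k u\<bar>) \<star> (\<lambda>_. 1)) (t - \<tau>))"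
proof -
  have k': "loc_int (\<lambda>u. \<bar>k u\<bar>)" "\<And>t. t \<le> 0 \<Longrightarrow> \<bar>k t\<bar> = 0"
    using k by (auto intro: loc_int_abs)
  have c1: "continuous_on {-\<tau>..} (\<lambda>_. 1::real)" by simp
  have int1: "set_integrable lborel {0..<\<tau>} (\<lambda>s. \<bar>k (t - s)\<bar>)"
    using delay_conv_integrable[OF k' \<tau> c1, of t] by simp
  have "\<bar>LINT s:{0..<\<tau>}|lborel. k (t - s) * x (s - \<tau>)\<bar> \<le> (LINT s:{0..<\<tau>}|lborel. \<bar>k (t - s) * x (s - \<tau>)\<bar>)"
    using set_integral_norm_bound[OF delay_conv_integrable[OF k \<tau> x, of t]] by simp
  also have "\<dots> \<le> (LINT s:{0..<\<tau>}|lborel. \<delta> * \<bar>k (t - s)\<bar>)"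
  proof (rule set_integral_mono)
    show "set_integrable lborel {0..<\<tau>} (\<lambda>s. \<bar>k (t - s) * x (s - \<tau>)\<bar>)"
      using set_integrable_norm[OF delay_conv_integrable[OF k \<tau> x, of t]] by simp
    show "set_integrable lborel {0..<\<tau>} (\<lambda>s. \<delta> * \<bar>k (t - s)\<bar>)" using int1 by simp
    fix s assume "s \<in> {0..<\<tau>}"
    then have "\<bar>x (s - \<tau>)\<bar> \<le> \<delta>" using \<delta> by auto
    then show "\<bar>k (t - s) * x (s - \<tau>)\<bar> \<le> \<delta> * \<bar>k (t - s)\<bar>"
      using mult_left_mono[of "\<bar>x (s - \<tau>)\<bar>" \<delta> "\<bar>k (t - s)\<bar>"] by (simp add: abs_mult mult.commute)
  qed
  also have "\<dots> = \<delta> * (LINT s:{0..<\<tau>}|lborel. \<bar>k (t - s)\<bar>)" by simp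
  also have "(LINT s:{0..<\<tau>}|lborel. \<bar>k (t - s)\<bar>) =
      ((\<lambda>u. \<bar>k u\<bar>) \<star> (\<lambda>_. 1)) t - ((\<lambda>u. \<bar>k u\<bar>) \<star> (\<lambda>_. 1)) (t - \<tau>)"
    using delay_conv[OF k' \<tau> c1, of t] shift_conv_1[of "\<lambda>u. \<bar>k u\<bar>" \<tau> t, OF k'(2) \<tau>] by simp
  finally show ?thesis using delay_conv[OF k \<tau> x, of t] by simp
qed

lemma abs_conv_1_mono:
  assumes "loc_int k" "s \<le> t"
  shows "((\<lambda>u. \<bar>k u\<bar>) \<star> (\<lambda>_. 1)) s \<le> ((\<lambda>u. \<bar>k u\<bar>) \<star> (\<lambda>_. 1)) t"
  unfolding causal_conv_1 set_lebesgue_integral_def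
proof (rule integral_mono)
  show "integrable lborel (\<lambda>r. indicator {0..s} r *\<^sub>R \<bar>k r\<bar>)" "integrable lborel (\<lambda>r. indicator {0..t} r *\<^sub>R \<bar>k r\<bar>)"
    using loc_intD[OF loc_int_abs[OF assms(1)]] unfolding set_integrable_def by blast+
  show "indicator {0..s} r *\<^sub>R \<bar>k r\<bar> \<le> indicator {0..t} r *\<^sub>R \<bar>k r\<bar>" for r
    using assms(2) by (auto simp: indicator_def)
qed

text \<open>The time \<open>T\<close> after which \<open>w\<close> is below \<open>m\<close> is
  treated as a delay: \<open>w\<close> on \<open>[0, T]\<close> plays the role of the history,
  bounded by \<open>B\<close>, and the shifted remainder is bounded by \<open>m\<close>. The history
  then fades by \<open>delay_conv_diff_le\<close>.\<close>

lemma conv_eventually_le: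
  assumes k: "loc_int k" "\<And>t. t \<le> 0 \<Longrightarrow> k t = 0"
    and q: "\<And>t. ((\<lambda>u. \<bar>k u\<bar>) \<star> (\<lambda>_. 1)) t \<le> q"
    and w: "continuous_on {0..} w" "\<And>s. s \<ge> 0 \<Longrightarrow> \<bar>w s\<bar> \<le> B"
    and m: "eventually (\<lambda>t. \<bar>w t\<bar> \<le> m) at_top" and "m \<ge> 0" "e > 0"
  shows "eventually (\<lambda>t. \<bar>(k \<star> w) t\<bar> \<le> q * m + e) at_top"
proof -
  define M where "M = (\<lambda>u. \<bar>k u\<bar>) \<star> (\<lambda>_. 1)"
  have M_mono: "M s \<le> M t" if "s \<le> t" for s t
    unfolding M_def by (rule abs_conv_1_mono[OF k(1) that])
  have M_le: "M t \<le> q" for t unfolding M_def by (rule q)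
  have B: "B \<ge> 0" using w(2)[of 0] by auto
  obtain T0 where T0: "\<And>t. t \<ge> T0 \<Longrightarrow> \<bar>w t\<bar> \<le> m"
    using m by (auto simp: eventually_at_top_linorder)
  define T where "T = max T0 0"
  have T: "T \<ge> 0" by (simp add: T_def)
  define e' where "e' = e / (B + 1)"
  have e': "e' > 0" "B * e' \<le> e" using B \<open>e > 0\<close> by (auto simp: e'_def field_simps)
  have bdd: "bdd_above (range M)" using M_le by (rule bdd_aboveI2)
  \<comment> \<open>Beyond \<open>r\<close> less than \<open>e'\<close> of the mass is left, so for
    \<open>t - T \<ge> r\<close> the values of \<open>w\<close> on \<open>[0, T]\<close> contribute
    at most \<open>B * e' \<le> e\<close>.\<close>
  obtain r where r: "Sup (range M) - e' < M r"
    using less_cSup_iff[OF _ bdd, of "Sup (range M) - e'"] e' by auto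
  have "\<bar>(k \<star> w) t\<bar> \<le> q * m + e" if t: "t \<ge> r + T" for t
  proof -
    define x where "x = (\<lambda>s. w (s + T))"
    have x: "continuous_on {-T..} x"
      unfolding x_def by (rule continuous_on_compose2[OF w(1)]) (auto intro!: continuous_intros)
    have "\<bar>(k \<star> (\<lambda>s. x (s - T))) t - ((\<lambda>u. k (u - T)) \<star> x) t\<bar> \<le> B * (M t - M (t - T))"
      unfolding M_def using w(2) by (intro delay_conv_diff_le k T x) (auto simp: x_def)
    also have "(\<lambda>s. x (s - T)) = w" by (simp add: x_def)
    also have "M t - M (t - T) \<le> e'"
      using r M_mono[of r "t - T"] t cSUP_upper[OF _ bdd, of t] by simp
    then have "B * (M t - M (t - T)) \<le> e"
      using mult_left_mono[OF _ B] e'(2) by fastforce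
    finally have 1: "\<bar>(k \<star> w) t - ((\<lambda>u. k (u - T)) \<star> x) t\<bar> \<le> e" .
    have "\<bar>((\<lambda>u. k (u - T)) \<star> x) t\<bar> \<le> ((\<lambda>u. \<bar>k (u - T)\<bar>) \<star> (\<lambda>_. 1)) t * m"
      using T T0 by (intro abs_causal_conv_le loc_int_shift k continuous_on_subset[OF x]) (auto simp: x_def T_def)
    also have "((\<lambda>u. \<bar>k (u - T)\<bar>) \<star> (\<lambda>_. 1)) t = M (t - T)"
      unfolding M_def by (rule shift_conv_1) (use k T in auto)
    also have "M (t - T) * m \<le> q * m" using M_le \<open>m \<ge> 0\<close> by (intro mult_right_mono)
    finally show ?thesis using 1 by linarith
  qed
  then show ?thesis by (auto simp: eventually_at_top_linorder)
qed

text \<open>\<open>g\<close> is the loss in the triangle inequality and \<open>c\<close> its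
  integral over \<open>[0, 2 * \<tau>]\<close>. The mean of the two masses is at most 1, so the norm
  is at most \<open>1 - c\<close> from \<open>2 * \<tau>\<close> on, and for earlier
  \<open>t\<close> by monotonicity.\<close>

lemma delayed_resolvent_norm_less_1:
  assumes \<alpha>: "0 < \<alpha>" "\<alpha> < 1" and \<mu>: "\<mu> > 0" and \<tau>: "\<tau> > 0" and \<beta>: "-1 \<le> \<beta>" "\<beta> < 1"
  obtains q where "0 \<le> q" "q < 1"
    "\<And>t. ((\<lambda>u. \<bar>resolvent_kernel \<alpha> \<mu> u / 2 + \<beta> / 2 * resolvent_kernel \<alpha> \<mu> (u - \<tau>)\<bar>) \<star> (\<lambda>_. 1)) t \<le> q"
proof -
  define K where "K = resolvent_kernel \<alpha> \<mu>"
  define V where "V = resolvent_mass \<alpha> \<mu>"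
  define k where "k = (\<lambda>u. K u / 2 + \<beta> / 2 * K (u - \<tau>))"
  define g where "g = (\<lambda>u. (K u + K (u - \<tau>)) / 2 - \<bar>k u\<bar>)"
  have K: "loc_int K" unfolding K_def by (rule loc_int_resolvent_kernel[OF \<alpha>(1)])
  have K0: "t \<le> 0 \<Longrightarrow> K t = 0" for t by (simp add: K_def resolvent_kernel_def)
  have Kn: "K t \<ge> 0" for t unfolding K_def by (rule resolvent_kernel_nonneg[OF \<alpha> \<mu>])
  have Ks: "loc_int (\<lambda>u. K (u - \<tau>))" using \<tau> by (intro loc_int_shift K K0) auto
  have k: "loc_int k"
    unfolding loc_int_def k_def by (intro allI set_integral_add(1)) (use loc_intD[OF K] loc_intD[OF Ks] in auto)
  have kabs: "loc_int (\<lambda>u. \<bar>k u\<bar>)" by (rule loc_int_abs[OF k])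
  have g: "loc_int g"
    unfolding loc_int_def g_def add_divide_distrib
    by (intro allI set_integral_diff(1) set_integral_add(1)) (use loc_intD[OF K] loc_intD[OF Ks] loc_intD[OF kabs] in auto)
  have k_le: "\<bar>k u\<bar> \<le> (K u + K (u - \<tau>)) / 2" for u
  proof -
    have "\<bar>\<beta>\<bar> * K (u - \<tau>) \<le> 1 * K (u - \<tau>)" using \<beta> by (intro mult_right_mono Kn) auto
    then show ?thesis
      using abs_triangle_ineq[of "K u / 2" "\<beta> / 2 * K (u - \<tau>)"] Kn by (simp add: k_def abs_mult)
  qed
  then have g_nonneg: "g u \<ge> 0" for u by (simp add: g_def)
  \<comment> \<open>Where both shifted copies of \<open>K\<close> are positive,
    \<open>\<beta> < 1\<close> keeps \<open>k u\<close> below the mean of the copies, while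
    \<open>\<beta> \<ge> -1\<close> together with \<open>K u > 0\<close> keeps \<open>- k u\<close>
    below it.\<close>
  have g_pos: "g u > 0" if "u > \<tau>" for u
  proof -
    have "K u > 0" "K (u - \<tau>) > 0"
      unfolding K_def using resolvent_kernel_pos[OF \<alpha> \<mu>] that \<tau> by auto
    moreover have "\<beta> * K (u - \<tau>) < 1 * K (u - \<tau>)" "-1 * K (u - \<tau>) \<le> \<beta> * K (u - \<tau>)"
      using \<beta> \<open>K (u - \<tau>) > 0\<close> by (simp, intro mult_right_mono) auto
    ultimately have "\<bar>k u\<bar> < (K u + K (u - \<tau>)) / 2"
      unfolding k_def abs_less_iff by (simp add: field_simps)
    then show ?thesis by (simp add: g_def)
  qed
  define c where "c = (LINT u:{0..2*\<tau>}|lborel. g u)"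
  have g_int: "integrable lborel (\<lambda>u. indicator {0..2*\<tau>} u *\<^sub>R g u)"
    using loc_intD[OF g] by (simp add: set_integrable_def)
  have "c \<noteq> 0"
  proof
    assume "c = 0"
    then have "AE u in lborel. indicator {0..2*\<tau>} u *\<^sub>R g u = 0"
      unfolding c_def set_lebesgue_integral_def
      using integral_nonneg_eq_0_iff_AE[OF g_int] g_nonneg by (auto simp: indicator_def)
    then have "AE u in lborel. u \<notin> {\<tau><..<2*\<tau>}"
      by (rule eventually_mono) (use g_pos \<tau> in \<open>force simp: indicator_def split: if_splits\<close>)
    then have "emeasure lborel {\<tau><..<2*\<tau>} = 0"
      by (subst (asm) AE_iff_measurable[where N="{\<tau><..<2*\<tau>}"]) auto
    then show False using \<tau> by simp
  qed
  moreover have "c \<ge> 0"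
    unfolding c_def set_lebesgue_integral_def by (intro integral_nonneg_AE) (auto simp: g_nonneg)
  ultimately have c: "c > 0" by simp
  have large: "((\<lambda>u. \<bar>k u\<bar>) \<star> (\<lambda>_. 1)) t \<le> 1 - c" if t: "t \<ge> 2 * \<tau>" for t
  proof -
    have "((\<lambda>u. \<bar>k u\<bar>) \<star> (\<lambda>_. 1)) t = (LINT u:{0..t}|lborel. (K u / 2 + K (u - \<tau>) / 2) - g u)"
      by (simp add: causal_conv_1 g_def add_divide_distrib)
    also have "\<dots> = (LINT u:{0..t}|lborel. K u / 2 + K (u - \<tau>) / 2) - (LINT u:{0..t}|lborel. g u)"
      by (intro set_integral_diff(2) set_integral_add(1)) (use loc_intD[OF K] loc_intD[OF Ks] loc_intD[OF g] in auto)
    also have "(LINT u:{0..t}|lborel. K u / 2 + K (u - \<tau>) / 2) = (LINT u:{0..t}|lborel. K u / 2) + (LINT u:{0..t}|lborel. K (u - \<tau>) / 2)"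
      by (intro set_integral_add(2)) (use loc_intD[OF K] loc_intD[OF Ks] in auto)
    also have "(LINT u:{0..t}|lborel. K u / 2) = V t / 2"
      by (simp add: V_def resolvent_mass_def causal_conv_1 K_def)
    also have "(LINT u:{0..t}|lborel. K (u - \<tau>) / 2) = V (t - \<tau>) / 2"
      using shift_conv_1[of K \<tau> t, OF K0] \<tau> by (simp add: V_def resolvent_mass_def causal_conv_1 K_def)
    finally have eq: "((\<lambda>u. \<bar>k u\<bar>) \<star> (\<lambda>_. 1)) t = V t / 2 + V (t - \<tau>) / 2 - (LINT u:{0..t}|lborel. g u)" .
    have "V r \<le> 1" for r unfolding V_def by (rule resolvent_mass_le_1[OF \<alpha> \<mu>])
    from this[of t] this[of "t - \<tau>"] have "V t / 2 + V (t - \<tau>) / 2 \<le> 1" by simp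
    moreover have "(LINT u:{0..t}|lborel. g u) \<ge> c"
      unfolding c_def set_lebesgue_integral_def
    proof (rule integral_mono[OF g_int])
      show "integrable lborel (\<lambda>u. indicator {0..t} u *\<^sub>R g u)"
        using loc_intD[OF g] by (simp add: set_integrable_def)
      show "indicator {0..2*\<tau>} u *\<^sub>R g u \<le> indicator {0..t} u *\<^sub>R g u" for u
        using t g_nonneg[of u] by (auto simp: indicator_def)
    qed
    ultimately show ?thesis using eq by linarith
  qed
  show ?thesis
  proof (rule that[of "1 - c"])
    show "1 - c < 1" using c by simp
    show le: "((\<lambda>u. \<bar>resolvent_kernel \<alpha> \<mu> u / 2 + \<beta> / 2 * resolvent_kernel \<alpha> \<mu> (u - \<tau>)\<bar>) \<star> (\<lambda>_. 1)) t \<le> 1 - c" for t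
      using abs_conv_1_mono[OF k, of t "max t (2 * \<tau>)"] large[of "max t (2 * \<tau>)"] by (simp add: k_def K_def)
    show "0 \<le> 1 - c"
      using le[of 0] by (simp add: causal_conv_nonpos)
  qed
qed

section \<open>The delay equation with a globally Lipschitz perturbation\<close>

text \<open>\<open>g\<close> stands for the truncated nonlinearity, Lipschitz on the whole plane.
  The bound \<open>q\<close> is a parameter because \<open>\<eta>\<close> has to be chosen after it,
  so as to leave \<open>q + \<eta> / \<mu>\<close> below 1.\<close>

locale delay_equation =
  fixes \<alpha> \<tau> a b \<eta> q :: real and g :: "real \<Rightarrow> real \<Rightarrow> real"
  assumes \<alpha>: "0 < \<alpha>" "\<alpha> < 1" and \<tau>: "\<tau> > 0" and ab: "a \<le> b" "b < - a"
    and g_lipschitz: "\<And>u v u' v'. \<bar>g u v - g u' v'\<bar> \<le> \<eta> * max \<bar>u - u'\<bar> \<bar>v - v'\<bar>"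
    and g_0: "g 0 0 = 0"
    and q_bound: "\<And>t. ((\<lambda>u. \<bar>resolvent_kernel \<alpha> (- 2 * a) u / 2 +
          (b / - a) / 2 * resolvent_kernel \<alpha> (- 2 * a) (u - \<tau>)\<bar>) \<star> (\<lambda>_. 1)) t \<le> q"
    and q_nonneg: "0 \<le> q" and \<eta>_nonneg: "0 \<le> \<eta>" and contraction: "q + \<eta> / (- 2 * a) < 1"
begin

definition "\<mu> = - 2 * a"
definition "K = resolvent_kernel \<alpha> \<mu>"
definition "V = resolvent_mass \<alpha> \<mu>"
definition "\<kappa> = (\<lambda>u. K u / 2 + (b / - a) / 2 * K (u - \<tau>))"
definition "rate = q + \<eta> / \<mu>"
text \<open>The right-hand side of the equation with \<open>\<mu> * x\<close> added, hence the
  coefficient \<open>- a\<close> instead of \<open>a\<close>.\<close>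

definition "rhs x = (\<lambda>s. - a * x s + b * x (s - \<tau>) + g (x s) (x (s - \<tau>)))"
text \<open>The initial value \<open>c\<close> is separate from \<open>x\<close>, so that the map
  can be iterated with \<open>c\<close> held fixed; solutions are the fixed points with
  \<open>c = x 0\<close>.\<close>

definition "voc c x = (\<lambda>t. c * (1 - V t) + (1/\<mu>) * (K \<star> rhs x) t)"

lemma \<mu>_pos: "\<mu> > 0" using ab by (simp add: \<mu>_def)

lemma rate: "0 \<le> rate" "rate < 1"
  using q_nonneg \<eta>_nonneg \<mu>_pos contraction unfolding rate_def by (simp, simp only: \<mu>_def)

lemma \<eta>_div_le: "\<eta> / \<mu> \<le> 1"
  using rate(2) q_nonneg unfolding rate_def by linarith

lemma b_div: "\<bar>b / \<mu>\<bar> \<le> 1"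
  using ab by (auto simp: \<mu>_def abs_le_iff field_simps)

lemma K: "loc_int K" "t \<le> 0 \<Longrightarrow> K t = 0" "0 \<le> K t"
  unfolding K_def
  by (rule loc_int_resolvent_kernel[OF \<alpha>(1)], simp add: resolvent_kernel_def, rule resolvent_kernel_nonneg[OF \<alpha> \<mu>_pos])

lemma K_abs: "(\<lambda>u. \<bar>K u\<bar>) = K"
  using K(3) by auto

lemma K_conv_1: "K \<star> (\<lambda>_. 1) = V"
  by (simp add: K_def V_def resolvent_mass_def)

lemma V: "continuous_on {0..} V" "0 \<le> V t" "V t \<le> 1" "r \<le> 0 \<Longrightarrow> V r = 0" "(V \<longlongrightarrow> 1) at_top"
  unfolding V_def
  by (auto intro: continuous_resolvent_mass resolvent_mass_nonneg resolvent_mass_le_1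
      resolvent_mass_nonpos resolvent_mass_tendsto_1 \<alpha> \<mu>_pos)

lemma K_shift: "loc_int (\<lambda>u. K (u - \<tau>))"
  using \<tau> by (intro loc_int_shift K) auto

lemma \<kappa>: "loc_int \<kappa>" "t \<le> 0 \<Longrightarrow> \<kappa> t = 0" "((\<lambda>u. \<bar>\<kappa> u\<bar>) \<star> (\<lambda>_. 1)) t \<le> q"
proof -
  have "set_integrable lborel {0..T} (\<lambda>u. c * K (u - \<tau>))" for T c
    using loc_intD[OF K_shift] by simp
  moreover have "set_integrable lborel {0..T} (\<lambda>u. K u / 2)" for T
    using loc_intD[OF K(1)] by simp
  ultimately show "loc_int \<kappa>"
    unfolding loc_int_def \<kappa>_def by (intro allI set_integral_add(1))
  show "t \<le> 0 \<Longrightarrow> \<kappa> t = 0" using \<tau> by (simp add: \<kappa>_def K(2))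
  show "((\<lambda>u. \<bar>\<kappa> u\<bar>) \<star> (\<lambda>_. 1)) t \<le> q"
    using q_bound[of t] by (simp add: \<kappa>_def K_def \<mu>_def)
qed

lemma g_bound: "\<bar>g u v\<bar> \<le> \<eta> * max \<bar>u\<bar> \<bar>v\<bar>"
  using g_lipschitz[of u v 0 0] by (simp add: g_0)

lemma g_continuous:
  assumes "continuous_on A u" "continuous_on A v"
  shows "continuous_on A (\<lambda>s. g (u s) (v s))"
  unfolding continuous_on_def
proof
  fix s assume s: "s \<in> A"
  have "((\<lambda>r. \<eta> * max \<bar>u r - u s\<bar> \<bar>v r - v s\<bar>) \<longlongrightarrow> \<eta> * max \<bar>u s - u s\<bar> \<bar>v s - v s\<bar>) (at s within A)"
    using assms s unfolding continuous_on_def by (intro tendsto_intros) auto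
  then have "((\<lambda>r. \<eta> * max \<bar>u r - u s\<bar> \<bar>v r - v s\<bar>) \<longlongrightarrow> 0) (at s within A)" by simp
  then have "((\<lambda>r. g (u r) (v r) - g (u s) (v s)) \<longlongrightarrow> 0) (at s within A)"
    by (rule Lim_null_comparison[rotated]) (simp add: g_lipschitz)
  then show "((\<lambda>r. g (u r) (v r)) \<longlongrightarrow> g (u s) (v s)) (at s within A)"
    by (simp add: LIM_zero_iff)
qed

lemma delay_continuous:
  assumes "continuous_on {-\<tau>..} x"
  shows "continuous_on {0..} x" "continuous_on {0..} (\<lambda>s. x (s - \<tau>))"
proof -
  show "continuous_on {0..} x" using \<tau> by (intro continuous_on_subset[OF assms]) auto
  show "continuous_on {0..} (\<lambda>s. x (s - \<tau>))"
    by (rule continuous_on_compose2[OF assms]) (auto intro!: continuous_intros)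
qed

lemma rhs_continuous:
  assumes "continuous_on {-\<tau>..} x"
  shows "continuous_on {0..} (rhs x)"
  unfolding rhs_def by (intro continuous_intros g_continuous delay_continuous[OF assms])

lemma voc_continuous:
  assumes "continuous_on {-\<tau>..} x"
  shows "continuous_on {0..} (voc c x)"
  unfolding voc_def by (intro continuous_intros V continuous_causal_conv K rhs_continuous assms)

text \<open>With the delay moved into the kernel, both linear terms merge into
  \<open>\<kappa>\<close>, where they can cancel; the bracket is the contribution of the
  history.\<close>

lemma K_conv_decomposition:
  assumes x: "continuous_on {-\<tau>..} x" and w: "continuous_on {0..} w"
  shows "(1/\<mu>) * (K \<star> (\<lambda>s. - a * x s + b * x (s - \<tau>) + w s)) t =
    (\<kappa> \<star> x) t + (b/\<mu>) * ((K \<star> (\<lambda>s. x (s - \<tau>))) t - ((\<lambda>u. K (u - \<tau>)) \<star> x) t) + (1/\<mu>) * (K \<star> w) t"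
proof -
  note xc = delay_continuous[OF x]
  have "(K \<star> (\<lambda>s. - a * x s + b * x (s - \<tau>) + w s)) t =
      (K \<star> (\<lambda>s. - a * x s + b * x (s - \<tau>))) t + (K \<star> w) t"
    by (intro causal_conv_add K continuous_intros xc w)
  also have "(K \<star> (\<lambda>s. - a * x s + b * x (s - \<tau>))) t = (K \<star> (\<lambda>s. - a * x s)) t + (K \<star> (\<lambda>s. b * x (s - \<tau>))) t"
    by (intro causal_conv_add K continuous_intros xc)
  finally have 1: "(K \<star> (\<lambda>s. - a * x s + b * x (s - \<tau>) + w s)) t =
      - a * (K \<star> x) t + b * (K \<star> (\<lambda>s. x (s - \<tau>))) t + (K \<star> w) t"
    unfolding causal_conv_cmult .
  have half: "((\<lambda>u. K u / 2) \<star> x) t = (K \<star> x) t / 2"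
    using causal_conv_cmult[of x "1/2" K t] by (simp add: causal_conv_commute[of _ x])
  have "loc_int (\<lambda>u. K u / 2)" using K(1) by (simp add: loc_int_def)
  then have "(\<kappa> \<star> x) t = (K \<star> x) t / 2 + (b / - a) / 2 * ((\<lambda>u. K (u - \<tau>)) \<star> x) t"
    unfolding \<kappa>_def half[symmetric] by (intro causal_conv_add_left K_shift xc)
  then show ?thesis
    unfolding 1 using ab by (simp add: \<mu>_def field_simps)
qed

lemma delay_remainder_le:
  assumes "continuous_on {-\<tau>..} x" "\<And>s. -\<tau> \<le> s \<Longrightarrow> s \<le> 0 \<Longrightarrow> \<bar>x s\<bar> \<le> \<delta>"
  shows "\<bar>(K \<star> (\<lambda>s. x (s - \<tau>))) t - ((\<lambda>u. K (u - \<tau>)) \<star> x) t\<bar> \<le> \<delta> * (V t - V (t - \<tau>))"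
  using delay_conv_diff_le[OF K(1,2) _ assms] \<tau> by (simp add: K_abs K_conv_1)

lemma K_conv_le:
  assumes "continuous_on {0..} w" "\<And>s. 0 \<le> s \<Longrightarrow> s \<le> t \<Longrightarrow> \<bar>w s\<bar> \<le> C" "C \<ge> 0"
  shows "\<bar>(K \<star> w) t\<bar> \<le> C"
proof -
  have "\<bar>(K \<star> w) t\<bar> \<le> V t * C"
    using abs_causal_conv_le[OF K(1) assms(1,2)] by (simp add: K_abs K_conv_1)
  also have "\<dots> \<le> 1 * C" by (intro mult_right_mono V assms)
  finally show ?thesis by simp
qed

text \<open>Stated for a free forcing \<open>w\<close>, so that it serves both the difference of two
  functions with common history (\<open>\<delta> = 0\<close>) and a single function.\<close>

lemma linear_estimate:
  assumes x: "continuous_on {-\<tau>..} x" and w: "continuous_on {0..} w"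
    and \<delta>: "\<And>s. -\<tau> \<le> s \<Longrightarrow> s \<le> 0 \<Longrightarrow> \<bar>x s\<bar> \<le> \<delta>"
    and N: "\<And>s. 0 \<le> s \<Longrightarrow> s \<le> t \<Longrightarrow> \<bar>x s\<bar> \<le> N" "0 \<le> N"
    and C: "\<And>s. 0 \<le> s \<Longrightarrow> s \<le> t \<Longrightarrow> \<bar>w s\<bar> \<le> C" "0 \<le> C"
  shows "\<bar>(1/\<mu>) * (K \<star> (\<lambda>s. - a * x s + b * x (s - \<tau>) + w s)) t\<bar> \<le> q * N + \<delta> + C / \<mu>"
proof -
  define R where "R = (K \<star> (\<lambda>s. x (s - \<tau>))) t - ((\<lambda>u. K (u - \<tau>)) \<star> x) t"
  have \<delta>0: "\<delta> \<ge> 0" using \<delta>[of 0] \<tau> by auto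
  have "\<bar>(\<kappa> \<star> x) t\<bar> \<le> ((\<lambda>u. \<bar>\<kappa> u\<bar>) \<star> (\<lambda>_. 1)) t * N"
    by (rule abs_causal_conv_le[OF \<kappa>(1) delay_continuous(1)[OF x] N(1)])
  also have "\<dots> \<le> q * N" by (intro mult_right_mono \<kappa>(3) N)
  finally have 1: "\<bar>(\<kappa> \<star> x) t\<bar> \<le> q * N" .
  have "\<bar>R\<bar> \<le> \<delta> * (V t - V (t - \<tau>))"
    unfolding R_def by (rule delay_remainder_le[OF x \<delta>])
  also have "\<dots> \<le> \<delta> * 1" using V(3)[of t] V(2)[of "t - \<tau>"] by (intro mult_left_mono \<delta>0) linarith
  finally have R: "\<bar>R\<bar> \<le> \<delta>" by simp
  have "\<bar>(b/\<mu>) * R\<bar> \<le> 1 * \<delta>" unfolding abs_mult by (intro mult_mono b_div R) auto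
  then have 2: "\<bar>(b/\<mu>) * R\<bar> \<le> \<delta>" by simp
  have 3: "\<bar>(1/\<mu>) * (K \<star> w) t\<bar> \<le> C / \<mu>"
    using K_conv_le[OF w C] \<mu>_pos by (simp add: abs_mult divide_right_mono)
  show ?thesis
    unfolding K_conv_decomposition[OF x w] R_def[symmetric] using 1 2 3 by linarith
qed

lemma voc_contraction:
  assumes x: "continuous_on {-\<tau>..} x" and y: "continuous_on {-\<tau>..} y"
    and eq: "\<And>s. -\<tau> \<le> s \<Longrightarrow> s \<le> 0 \<Longrightarrow> x s = y s"
    and N: "\<And>s. 0 \<le> s \<Longrightarrow> s \<le> t \<Longrightarrow> \<bar>x s - y s\<bar> \<le> N" "0 \<le> N"
  shows "\<bar>voc c x t - voc c y t\<bar> \<le> rate * N"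
proof -
  define d where "d = (\<lambda>s. x s - y s)"
  define w where "w = (\<lambda>s. g (x s) (x (s - \<tau>)) - g (y s) (y (s - \<tau>)))"
  note cs = delay_continuous[OF x] delay_continuous[OF y]
  have d: "continuous_on {-\<tau>..} d" unfolding d_def by (intro continuous_intros x y)
  have w: "continuous_on {0..} w" unfolding w_def by (intro continuous_intros g_continuous cs)
  have dN: "\<bar>d s\<bar> \<le> N" if "-\<tau> \<le> s" "s \<le> t" for s
    using N eq[of s] that by (cases "s \<le> 0") (auto simp: d_def)
  have wN: "\<bar>w s\<bar> \<le> \<eta> * N" if "0 \<le> s" "s \<le> t" for s
  proof -
    have "\<bar>w s\<bar> \<le> \<eta> * max \<bar>d s\<bar> \<bar>d (s - \<tau>)\<bar>"
      unfolding w_def d_def by (rule g_lipschitz)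
    also have "\<dots> \<le> \<eta> * N" using that \<tau> by (intro mult_left_mono \<eta>_nonneg) (auto intro!: dN)
    finally show ?thesis .
  qed
  have "voc c x t - voc c y t = (1/\<mu>) * ((K \<star> rhs x) t - (K \<star> rhs y) t)"
    by (simp add: voc_def right_diff_distrib)
  also have "(K \<star> rhs x) t - (K \<star> rhs y) t = (K \<star> (\<lambda>s. rhs x s - rhs y s)) t"
    by (rule causal_conv_diff[symmetric]) (intro K rhs_continuous x y)+
  also have "(\<lambda>s. rhs x s - rhs y s) = (\<lambda>s. - a * d s + b * d (s - \<tau>) + w s)"
    by (auto simp: rhs_def d_def w_def algebra_simps)
  finally have "\<bar>voc c x t - voc c y t\<bar> \<le> q * N + 0 + (\<eta> * N) / \<mu>"
    using linear_estimate[OF d w, of 0 t N "\<eta> * N"] dN wN N(2) \<eta>_nonneg eq \<tau> by (simp add: d_def)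
  then show ?thesis by (simp add: rate_def algebra_simps)
qed

text \<open>The three copies of \<open>\<delta>\<close> come from the initial value, from the
  history in the linear delay term, and from the history inside \<open>g\<close>, the last with
  factor \<open>\<eta> / \<mu> \<le> 1\<close>.\<close>

lemma voc_bound:
  assumes x: "continuous_on {-\<tau>..} x"
    and \<delta>: "\<And>s. -\<tau> \<le> s \<Longrightarrow> s \<le> 0 \<Longrightarrow> \<bar>x s\<bar> \<le> \<delta>"
    and N: "\<And>s. 0 \<le> s \<Longrightarrow> s \<le> t \<Longrightarrow> \<bar>x s\<bar> \<le> N" "0 \<le> N" and c: "\<bar>c\<bar> \<le> \<delta>"
  shows "\<bar>voc c x t\<bar> \<le> rate * N + 3 * \<delta>"
proof -
  define w where "w = (\<lambda>s. g (x s) (x (s - \<tau>)))"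
  have \<delta>0: "\<delta> \<ge> 0" using c by auto
  have w: "continuous_on {0..} w" unfolding w_def by (intro g_continuous delay_continuous x)
  have wN: "\<bar>w s\<bar> \<le> \<eta> * (N + \<delta>)" if "0 \<le> s" "s \<le> t" for s
  proof -
    have "\<bar>x (s - \<tau>)\<bar> \<le> N + \<delta>"
      using N(1)[of "s - \<tau>"] \<delta>[of "s - \<tau>"] that \<tau> N(2) \<delta>0 by (cases "s \<le> \<tau>") auto
    moreover have "\<bar>x s\<bar> \<le> N + \<delta>" using N(1)[of s] that \<delta>0 by auto
    ultimately have "\<eta> * max \<bar>x s\<bar> \<bar>x (s - \<tau>)\<bar> \<le> \<eta> * (N + \<delta>)"
      by (intro mult_left_mono \<eta>_nonneg) auto
    then show ?thesis using g_bound[of "x s" "x (s - \<tau>)"] by (simp add: w_def)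
  qed
  have "\<bar>(1/\<mu>) * (K \<star> rhs x) t\<bar> \<le> q * N + \<delta> + \<eta> * (N + \<delta>) / \<mu>"
    using linear_estimate[OF x w \<delta> N wN] N(2) \<delta>0 \<eta>_nonneg by (simp add: rhs_def w_def)
  moreover have "\<bar>c * (1 - V t)\<bar> \<le> \<delta> * 1"
    unfolding abs_mult using V(2,3)[of t] c by (intro mult_mono) auto
  moreover have "\<eta> / \<mu> * \<delta> \<le> 1 * \<delta>" using \<eta>_div_le \<delta>0 by (intro mult_right_mono)
  moreover have "q * N + \<eta> * (N + \<delta>) / \<mu> = rate * N + \<eta> / \<mu> * \<delta>"
    by (simp add: rate_def algebra_simps add_divide_distrib)
  ultimately show ?thesis unfolding voc_def by linarith
qed

text \<open>At a maximum point of \<open>\<bar>x\<bar>\<close> on \<open>[0, T]\<close> the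
  inequality \<open>voc_bound\<close> closes on itself and can be solved for the maximum. The
  resulting bound is the same for all \<open>T\<close>.\<close>

lemma a_priori_bound:
  assumes x: "continuous_on {-\<tau>..} x"
    and \<delta>: "\<And>s. -\<tau> \<le> s \<Longrightarrow> s \<le> 0 \<Longrightarrow> \<bar>x s\<bar> \<le> \<delta>"
    and eq: "\<And>s. 0 \<le> s \<Longrightarrow> s \<le> T \<Longrightarrow> x s = voc (x 0) x s" and t: "0 \<le> t" "t \<le> T"
  shows "\<bar>x t\<bar> \<le> 3 * \<delta> / (1 - rate)"
proof -
  have "continuous_on {0..T} (\<lambda>s. \<bar>x s\<bar>)"
    by (intro continuous_intros continuous_on_subset[OF delay_continuous(1)[OF x]]) auto
  then obtain m where m: "m \<in> {0..T}" "\<And>s. s \<in> {0..T} \<Longrightarrow> \<bar>x s\<bar> \<le> \<bar>x m\<bar>"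
    using continuous_attains_sup[of "{0..T}" "\<lambda>s. \<bar>x s\<bar>"] t by fastforce
  have "\<bar>voc (x 0) x m\<bar> \<le> rate * \<bar>x m\<bar> + 3 * \<delta>"
    using m \<tau> by (intro voc_bound x \<delta>) auto
  then have "\<bar>x m\<bar> \<le> rate * \<bar>x m\<bar> + 3 * \<delta>"
    using eq[of m] m(1) by simp
  then have "\<bar>x m\<bar> \<le> 3 * \<delta> / (1 - rate)"
    using rate by (simp add: field_simps)
  then show ?thesis using m(2)[of t] t by auto
qed

text \<open>Of the four contributions, the initial value and the history die out because
  \<open>V\<close> tends to 1, and the two convolutions pass the eventual bound \<open>m\<close> on
  with factors \<open>q\<close> and \<open>\<eta> / \<mu>\<close>. Each is granted an error
  \<open>e/4\<close>.\<close>

lemma eventually_contracts: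
  assumes x: "continuous_on {-\<tau>..} x" and B: "\<And>s. -\<tau> \<le> s \<Longrightarrow> \<bar>x s\<bar> \<le> B"
    and eq: "\<And>s. 0 \<le> s \<Longrightarrow> x s = voc (x 0) x s"
    and m: "eventually (\<lambda>t. \<bar>x t\<bar> \<le> m) at_top" "0 \<le> m" and e: "e > 0"
  shows "eventually (\<lambda>t. \<bar>x t\<bar> \<le> rate * m + e) at_top"
proof -
  define w where "w = (\<lambda>s. g (x s) (x (s - \<tau>)))"
  define R where "R = (\<lambda>t. (K \<star> (\<lambda>s. x (s - \<tau>))) t - ((\<lambda>u. K (u - \<tau>)) \<star> x) t)"
  note xc = delay_continuous[OF x]
  have w: "continuous_on {0..} w" unfolding w_def by (intro g_continuous xc)
  have B0: "B \<ge> 0" using B[of 0] \<tau> by auto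
  have m_shift: "eventually (\<lambda>t. \<bar>x (t - \<tau>)\<bar> \<le> m) at_top"
    using m(1) by (auto simp: eventually_at_top_linorder) (metis add.commute le_diff_eq)
  have 1: "eventually (\<lambda>t. \<bar>(\<kappa> \<star> x) t\<bar> \<le> q * m + e/4) at_top"
    using B \<tau> e by (intro conv_eventually_le[where B=B, OF \<kappa>(1) _ _ xc(1) _ m]) (auto simp: \<kappa>)
  have w_le: "\<bar>w s\<bar> \<le> \<eta> * max \<bar>x s\<bar> \<bar>x (s - \<tau>)\<bar>" for s
    unfolding w_def by (rule g_bound)
  have wB: "\<bar>w s\<bar> \<le> \<eta> * B" if "0 \<le> s" for s
    using w_le[of s] that B[of s] B[of "s - \<tau>"] \<tau> mult_left_mono[OF _ \<eta>_nonneg, of "max \<bar>x s\<bar> \<bar>x (s - \<tau>)\<bar>" B]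
    by auto
  have wm: "eventually (\<lambda>t. \<bar>w t\<bar> \<le> \<eta> * m) at_top"
    using m(1) m_shift
  proof eventually_elim
    case (elim t)
    then show ?case
      using w_le[of t] mult_left_mono[OF _ \<eta>_nonneg, of "max \<bar>x t\<bar> \<bar>x (t - \<tau>)\<bar>" m] by auto
  qed
  \<comment> \<open>The allowance is \<open>\<mu> * (e/4)\<close> because this convolution enters
    with the factor \<open>1/\<mu>\<close>; \<open>K\<close> itself has norm at most 1.\<close>
  have 2: "eventually (\<lambda>t. \<bar>(K \<star> w) t\<bar> \<le> 1 * (\<eta> * m) + \<mu> * (e/4)) at_top"
    using e m(2) \<eta>_nonneg \<mu>_pos
    by (intro conv_eventually_le[OF K(1) _ _ w wB wm]) (auto simp: K K_abs K_conv_1 V)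
  have "((\<lambda>t. V (t - \<tau>)) \<longlongrightarrow> 1) at_top"
    by (rule filterlim_compose[OF V(5)]) (rule filterlim_at_top_mono[of "\<lambda>t. t - \<tau>"], auto intro!: filterlim_tendsto_add_at_top[where f="\<lambda>_. -\<tau>", simplified] filterlim_ident)
  then have "((\<lambda>t. B * (V t - V (t - \<tau>))) \<longlongrightarrow> B * (1 - 1)) at_top"
    by (intro tendsto_intros V)
  then have "eventually (\<lambda>t. B * (V t - V (t - \<tau>)) < e/4) at_top"
    using e by (intro order_tendstoD(2)[where y="B * (1 - 1)"]) auto
  then have 3: "eventually (\<lambda>t. \<bar>(b/\<mu>) * R t\<bar> \<le> e/4) at_top"
  proof eventually_elim
    case (elim t)
    have "\<bar>R t\<bar> \<le> B * (V t - V (t - \<tau>))"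
      unfolding R_def using B by (intro delay_remainder_le x) auto
    then have "\<bar>R t\<bar> \<le> e/4" using elim by linarith
    then have "\<bar>(b/\<mu>) * R t\<bar> \<le> 1 * (e/4)" unfolding abs_mult using b_div by (intro mult_mono) auto
    then show ?case by simp
  qed
  have "((\<lambda>t. \<bar>x 0 * (1 - V t)\<bar>) \<longlongrightarrow> \<bar>x 0 * (1 - 1)\<bar>) at_top"
    by (intro tendsto_intros V)
  then have 4: "eventually (\<lambda>t. \<bar>x 0 * (1 - V t)\<bar> < e/4) at_top"
    using e by (intro order_tendstoD(2)[where y="\<bar>x 0 * (1 - 1)\<bar>"]) auto
  show ?thesis
    using 1 2 3 4 eventually_ge_at_top[of 0]
  proof eventually_elim
    case (elim t)
    have "x t = x 0 * (1 - V t) + ((\<kappa> \<star> x) t + (b/\<mu>) * R t + (1/\<mu>) * (K \<star> w) t)"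
      using eq[of t] elim(5) K_conv_decomposition[OF x w, of t] by (simp add: voc_def rhs_def w_def R_def)
    moreover have "\<bar>(1/\<mu>) * (K \<star> w) t\<bar> \<le> \<eta> / \<mu> * m + e/4"
    proof -
      have "\<bar>(1/\<mu>) * (K \<star> w) t\<bar> = \<bar>(K \<star> w) t\<bar> / \<mu>" using \<mu>_pos by (simp add: abs_mult)
      also have "\<dots> \<le> (1 * (\<eta> * m) + \<mu> * (e/4)) / \<mu>" using elim(2) \<mu>_pos by (intro divide_right_mono) auto
      also have "\<dots> = \<eta> / \<mu> * m + e/4" using \<mu>_pos by (simp add: add_divide_distrib)
      finally show ?thesis .
    qed
    ultimately have "\<bar>x t\<bar> \<le> q * m + \<eta> / \<mu> * m + e"
      using elim by linarith
    then show ?case by (simp add: rate_def distrib_right)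
  qed
qed

lemma solution_tendsto_0:
  assumes x: "continuous_on {-\<tau>..} x" and B: "\<And>s. -\<tau> \<le> s \<Longrightarrow> \<bar>x s\<bar> \<le> B"
    and eq: "\<And>s. 0 \<le> s \<Longrightarrow> x s = voc (x 0) x s"
  shows "(x \<longlongrightarrow> 0) at_top"
proof -
  \<comment> \<open>\<open>Inf S\<close> is the limit superior of \<open>\<bar>x\<bar>\<close>;
    \<open>eventually_contracts\<close> turns into \<open>Inf S \<le> rate * Inf S\<close>.\<close>
  define S where "S = {m. 0 \<le> m \<and> eventually (\<lambda>t. \<bar>x t\<bar> \<le> m) at_top}"
  have "B \<ge> 0" using B[of 0] \<tau> by auto
  moreover have "eventually (\<lambda>t. \<bar>x t\<bar> \<le> B) at_top"
    using eventually_ge_at_top[of 0] by eventually_elim (use B \<tau> in auto)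
  ultimately have "B \<in> S" by (simp add: S_def)
  then have ne: "S \<noteq> {}" by auto
  have bdd: "bdd_below S" unfolding S_def by (rule bdd_belowI[of _ 0]) auto
  define i where "i = Inf S"
  have i0: "i \<ge> 0" unfolding i_def by (rule cInf_greatest[OF ne]) (simp add: S_def)
  have step: "rate * m + e \<in> S" if "m \<in> S" "e > 0" for m e
    using eventually_contracts[OF x B eq, of m e] that rate by (auto simp: S_def)
  have near: "\<exists>m\<in>S. m < i + e" if "e > 0" for e
    using cInf_lessD[OF ne, of "i + e"] that by (auto simp: i_def)
  have "i \<le> rate * i + e" if e: "e > 0" for e
  proof -
    obtain m where m: "m \<in> S" "m < i + e/2" using near[of "e/2"] e by auto
    have "i \<le> rate * m + e/2" unfolding i_def using step[OF m(1), of "e/2"] e by (intro cInf_lower bdd) auto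
    also have "rate * m \<le> rate * (i + e/2)" using m(2) rate by (intro mult_left_mono) auto
    also have "rate * (i + e/2) \<le> rate * i + e/2"
      using rate e mult_right_mono[of rate 1 "e/2"] by (simp add: distrib_left)
    finally show ?thesis by simp
  qed
  then have "i \<le> rate * i" by (rule field_le_epsilon)
  then have "(1 - rate) * i \<le> 0" by (simp add: algebra_simps)
  then have "i = 0" using i0 rate by (simp add: mult_le_0_iff)
  show ?thesis
  proof (rule tendstoI)
    fix e :: real assume "e > 0"
    then obtain m where m: "m \<in> S" "m < e" using near[of e] \<open>i = 0\<close> by auto
    then have "eventually (\<lambda>t. \<bar>x t\<bar> \<le> m) at_top" by (simp add: S_def)
    then show "eventually (\<lambda>t. dist (x t) 0 < e) at_top"
      by eventually_elim (use m in auto)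
  qed
qed

text \<open>Banach's theorem in the bounded continuous functions on the line, on the closed set of
  those with prescribed values up to time 0. Since \<open>rate\<close> is a contraction constant for
  the sup norm over all times, the fixed point is global at once.\<close>

lemma voc_fixed_point:
  assumes \<phi>: "continuous_on {-\<tau>..0} \<phi>"
  obtains x where "continuous_on UNIV x" "\<And>t. -\<tau> \<le> t \<Longrightarrow> t \<le> 0 \<Longrightarrow> x t = \<phi> t"
    "\<And>t. 0 \<le> t \<Longrightarrow> x t = voc (x 0) x t"
proof -
  \<comment> \<open>The type of bounded continuous functions demands values on the whole line, so
    \<open>\<phi>\<close> is extended by its end values.\<close>
  define \<Phi> where "\<Phi> = (\<lambda>t. \<phi> (max (-\<tau>) (min t 0)))"
  have \<Phi>_cont: "continuous_on UNIV \<Phi>"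
    unfolding \<Phi>_def by (rule continuous_on_compose2[OF \<phi>]) (use \<tau> in \<open>auto intro!: continuous_intros\<close>)
  have "bounded (\<phi> ` {-\<tau>..0})"
    by (intro compact_imp_bounded compact_continuous_image \<phi>) auto
  then obtain A where A: "\<forall>t\<in>{-\<tau>..0}. \<bar>\<phi> t\<bar> \<le> A" unfolding bounded_iff by auto
  have \<Phi>_bd: "\<bar>\<Phi> t\<bar> \<le> A" for t using A \<tau> by (simp add: \<Phi>_def)
  define step where "step = (\<lambda>x t. if t \<le> 0 then \<Phi> t else voc (\<Phi> 0) x t)"
  have voc_0: "voc c x 0 = c" for c x by (simp add: voc_def V causal_conv_nonpos)
  have step_bc: "step (apply_bcontfun x) \<in> bcontfun" for x
  proof (rule bcontfun_normI)
    have xc: "continuous_on {-\<tau>..} (apply_bcontfun x)" by simp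
    have "continuous_on ({..0} \<union> {0..}) (\<lambda>t. if t \<le> 0 then \<Phi> t else voc (\<Phi> 0) x t)"
      by (intro continuous_on_cases continuous_on_subset[OF \<Phi>_cont] voc_continuous xc) (auto simp: voc_0)
    also have "{..0} \<union> {0..} = (UNIV :: real set)" by auto
    finally show "continuous_on UNIV (step (apply_bcontfun x))" by (simp add: step_def)
    show "norm (step (apply_bcontfun x) t) \<le> rate * norm x + 3 * max A (norm x)" for t
    proof (cases "t \<le> 0")
      case True
      have "0 \<le> rate * norm x" using rate by simp
      then show ?thesis using True \<Phi>_bd[of t] by (simp add: step_def)
    next
      case False
      have "\<bar>apply_bcontfun x s\<bar> \<le> norm x" for s using norm_bounded[of x s] by simp
      then have "\<bar>voc (\<Phi> 0) x t\<bar> \<le> rate * norm x + 3 * max A (norm x)"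
        by (intro voc_bound xc) (auto intro: le_max_iff_disj[THEN iffD2] \<Phi>_bd)
      then show ?thesis using False by (simp add: step_def)
    qed
  qed
  define F where "F = (\<lambda>x. Bcontfun (step (apply_bcontfun x)))"
  have F: "apply_bcontfun (F x) = step (apply_bcontfun x)" for x
    unfolding F_def by (rule Bcontfun_inverse[OF step_bc])
  define S where "S = PiC {..0} (\<lambda>t. {\<Phi> t})"
  have S: "x \<in> S \<longleftrightarrow> (\<forall>t\<le>0. apply_bcontfun x t = \<Phi> t)" for x
    unfolding S_def mem_PiC_iff by auto
  have F_S: "F x \<in> S" for x by (simp add: S F step_def)
  have "\<exists>!x\<in>S. F x = x"
  proof (rule Banach_fix)
    show "complete S" unfolding complete_eq_closed S_def by (rule closed_PiC) simp
    show "S \<noteq> {}" using F_S by blast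
    show "0 \<le> rate" "rate < 1" by (rule rate)+
    show "F ` S \<subseteq> S" using F_S by blast
    fix x y assume xy: "x \<in> S" "y \<in> S"
    show "dist (F x) (F y) \<le> rate * dist x y"
    proof (rule dist_bound)
      fix t
      show "dist (apply_bcontfun (F x) t) (apply_bcontfun (F y) t) \<le> rate * dist x y"
      proof (cases "t \<le> 0")
        case True
        then show ?thesis using rate by (simp add: F step_def)
      next
        case False
        have "\<bar>voc (\<Phi> 0) x t - voc (\<Phi> 0) y t\<bar> \<le> rate * dist x y"
        proof (rule voc_contraction)
          show "\<bar>apply_bcontfun x s - apply_bcontfun y s\<bar> \<le> dist x y" for s
            using dist_bounded[of x s y] by (simp add: dist_real_def)
        qed (use xy in \<open>auto simp: S\<close>)
        then show ?thesis using False by (simp add: F step_def dist_real_def)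
      qed
    qed
  qed
  then obtain x where x: "x \<in> S" "F x = x" by blast
  then have x_step: "apply_bcontfun x = step (apply_bcontfun x)" using F by metis
  show ?thesis
  proof (rule that[of "apply_bcontfun x"])
    show "continuous_on UNIV (apply_bcontfun x)" by simp
    show "apply_bcontfun x t = \<phi> t" if "-\<tau> \<le> t" "t \<le> 0" for t
      using x(1) that by (simp add: S \<Phi>_def)
    have x0: "apply_bcontfun x 0 = \<Phi> 0" using x(1) by (simp add: S)
    show "apply_bcontfun x t = voc (apply_bcontfun x 0) x t" if "0 \<le> t" for t
    proof (cases "t = 0")
      case False
      then show ?thesis using fun_cong[OF x_step, of t] that x0 by (simp add: step_def)
    qed (simp add: voc_0)
  qed
qed

lemma caputo_iff_voc:
  assumes x: "continuous_on {-\<tau>..} x" and T: "T > 0"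
  shows "(\<forall>t\<in>{0..T}. caputo_prim \<alpha> x t =
            integral {0..t} (\<lambda>s. a * x s + b * x (s - \<tau>) + g (x s) (x (s - \<tau>)))) \<longleftrightarrow>
         (\<forall>t\<in>{0..T}. x t = voc (x 0) x t)"
proof -
  have F: "(\<lambda>s. a * x s + b * x (s - \<tau>) + g (x s) (x (s - \<tau>))) = (\<lambda>s. rhs x s - \<mu> * x s)"
    by (auto simp: rhs_def \<mu>_def algebra_simps)
  have x0: "continuous_on {0..} x" by (rule delay_continuous[OF x])
  have Fc: "continuous_on {0..} (\<lambda>s. rhs x s - \<mu> * x s)"
    by (intro continuous_intros rhs_continuous x x0)
  show ?thesis
    unfolding F caputo_prim_iff_volterra[OF \<alpha> x0 Fc T] voc_def K_def V_def
    by (rule volterra_iff_resolvent[OF \<alpha>(1) \<mu>_pos x0 rhs_continuous[OF x]])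
qed

end

section \<open>Localisation to small solutions\<close>

text \<open>A bound on the supremum \<open>lip_const f \<rho>\<close> controls single quotients only
  once their set is known to be bounded above. Local Lipschitz continuity at the origin supplies
  this with constant \<open>2 * L\<close>, the 2 coming from Euclidean versus maximum norm.\<close>

lemma lip_const_small:
  assumes lip: "loc_lipschitz2 f" and lim: "(lip_const f \<longlongrightarrow> 0) (at_right 0)" and "\<eta> > 0"
  obtains \<rho> where "\<rho> > 0"
    "\<And>x y x' y'. \<bar>x\<bar> \<le> \<rho> \<Longrightarrow> \<bar>y\<bar> \<le> \<rho> \<Longrightarrow> \<bar>x'\<bar> \<le> \<rho> \<Longrightarrow> \<bar>y'\<bar> \<le> \<rho> \<Longrightarrow>
      \<bar>f x y - f x' y'\<bar> \<le> \<eta> * max \<bar>x - x'\<bar> \<bar>y - y'\<bar>"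
proof -
  obtain e L where e: "e > 0" and L: "L-lipschitz_on (cball (0, 0) e) (\<lambda>(x, y). f x y)"
    using lip unfolding loc_lipschitz2_def by blast
  have "eventually (\<lambda>\<rho>. lip_const f \<rho> < \<eta>) (at_right 0)"
    using order_tendstoD(2)[OF lim \<open>\<eta> > 0\<close>] .
  then obtain \<rho>1 where \<rho>1: "\<rho>1 > 0" "\<And>\<rho>. 0 < \<rho> \<Longrightarrow> \<rho> < \<rho>1 \<Longrightarrow> lip_const f \<rho> < \<eta>"
    unfolding eventually_at_right_field by auto
  \<comment> \<open>\<open>e / 2\<close> puts the square of half-width \<open>\<rho>\<close> inside
    the ball of radius \<open>e\<close>, and \<open>\<rho>1 / 2\<close> makes
    \<open>\<rho> < \<rho>1\<close> strict.\<close>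
  define \<rho> where "\<rho> = min (\<rho>1 / 2) (e / 2)"
  have \<rho>: "\<rho> > 0" "\<rho> < \<rho>1" "2 * \<rho> \<le> e" using \<rho>1(1) e by (auto simp: \<rho>_def)
  have L0: "L \<ge> 0" using L by (rule lipschitz_on_nonneg)
  have bound: "\<bar>f x y - f x' y'\<bar> \<le> (2 * L) * max \<bar>x - x'\<bar> \<bar>y - y'\<bar>"
    if "\<bar>x\<bar> \<le> \<rho>" "\<bar>y\<bar> \<le> \<rho>" "\<bar>x'\<bar> \<le> \<rho>" "\<bar>y'\<bar> \<le> \<rho>" for x y x' y'
  proof -
    have mem: "(u, v) \<in> cball (0, 0) e" if "\<bar>u\<bar> \<le> \<rho>" "\<bar>v\<bar> \<le> \<rho>" for u v :: real
      using norm_Pair_le[of "-u" "-v"] that \<rho>(3) by (simp add: dist_norm norm_minus_commute)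
    have "\<bar>f x y - f x' y'\<bar> \<le> L * dist (x, y) (x', y')"
      using lipschitz_onD[OF L mem[OF that(1,2)] mem[OF that(3,4)]] by (simp add: dist_real_def)
    also have "dist (x, y) (x', y') \<le> 2 * max \<bar>x - x'\<bar> \<bar>y - y'\<bar>"
      using norm_Pair_le[of "x - x'" "y - y'"] by (auto simp: dist_norm max_def)
    finally show ?thesis using L0 by (simp add: mult_left_mono mult.assoc)
  qed
  show ?thesis
  proof (rule that[OF \<rho>(1)])
    fix x y x' y' :: real
    assume box: "\<bar>x\<bar> \<le> \<rho>" "\<bar>y\<bar> \<le> \<rho>" "\<bar>x'\<bar> \<le> \<rho>" "\<bar>y'\<bar> \<le> \<rho>"
    show "\<bar>f x y - f x' y'\<bar> \<le> \<eta> * max \<bar>x - x'\<bar> \<bar>y - y'\<bar>"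
    proof (cases "(x, y) = (x', y')")
      case False
      then have m: "max \<bar>x - x'\<bar> \<bar>y - y'\<bar> > 0" by (auto simp: less_max_iff_disj)
      define Q where "Q = {\<bar>f x y - f x' y'\<bar> / max \<bar>x - x'\<bar> \<bar>y - y'\<bar> | x y x' y'.
         x \<in> {-\<rho>..\<rho>} \<and> y \<in> {-\<rho>..\<rho>} \<and> x' \<in> {-\<rho>..\<rho>} \<and> y' \<in> {-\<rho>..\<rho>} \<and> (x, y) \<noteq> (x', y')}"
      have "bdd_above Q"
      proof (rule bdd_aboveI[of _ "2 * L"])
        fix r assume "r \<in> Q"
        then obtain u v u' v' where r: "r = \<bar>f u v - f u' v'\<bar> / max \<bar>u - u'\<bar> \<bar>v - v'\<bar>"
          and mem: "u \<in> {-\<rho>..\<rho>}" "v \<in> {-\<rho>..\<rho>}" "u' \<in> {-\<rho>..\<rho>}" "v' \<in> {-\<rho>..\<rho>}" and ne: "(u, v) \<noteq> (u', v')"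
          unfolding Q_def by blast
        have uv: "\<bar>u\<bar> \<le> \<rho>" "\<bar>v\<bar> \<le> \<rho>" "\<bar>u'\<bar> \<le> \<rho>" "\<bar>v'\<bar> \<le> \<rho>"
          using mem by auto
        have "max \<bar>u - u'\<bar> \<bar>v - v'\<bar> > 0" using ne by (auto simp: less_max_iff_disj)
        then show "r \<le> 2 * L" using bound[OF uv] by (simp add: r pos_divide_le_eq)
      qed
      moreover have "\<bar>f x y - f x' y'\<bar> / max \<bar>x - x'\<bar> \<bar>y - y'\<bar> \<in> Q"
      proof -
        have "x \<in> {-\<rho>..\<rho>} \<and> y \<in> {-\<rho>..\<rho>} \<and> x' \<in> {-\<rho>..\<rho>} \<and> y' \<in> {-\<rho>..\<rho>}"
          using box by (auto simp: abs_le_iff)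
        then show ?thesis unfolding Q_def using False by blast
      qed
      ultimately have "\<bar>f x y - f x' y'\<bar> / max \<bar>x - x'\<bar> \<bar>y - y'\<bar> \<le> lip_const f \<rho>"
        unfolding lip_const_def Q_def by (rule cSup_upper[rotated])
      also have "\<dots> \<le> \<eta>" using \<rho>1(2)[OF \<rho>(1,2)] by simp
      finally show ?thesis using m by (simp add: pos_divide_le_eq)
    qed simp
  qed
qed

text \<open>Existence comes from the truncated equation, whose solution is too small to notice the
  truncation. An arbitrary solution of the original equation is kept in the same region by a
  first-exit argument and then inherits the bound and the decay.\<close>

lemma small_initial_data:
  assumes \<alpha>: "0 < \<alpha>" "\<alpha> < 1" and \<tau>: "0 < \<tau>" and ab: "a \<le> b" "b < - a"
    and lip: "loc_lipschitz2 f" and f0: "f 0 0 = 0" and lim: "(lip_const f \<longlongrightarrow> 0) (at_right 0)"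
    and \<epsilon>: "\<epsilon> > 0"
  shows "\<exists>\<delta>>0. \<forall>\<phi>. small_init \<tau> \<delta> \<phi> \<longrightarrow>
      (\<exists>x. is_global_solution \<alpha> \<tau> a b f \<phi> x) \<and>
      (\<forall>x. is_global_solution \<alpha> \<tau> a b f \<phi> x \<longrightarrow> (\<forall>t\<ge>0. \<bar>x t\<bar> \<le> \<epsilon>) \<and> (x \<longlongrightarrow> 0) at_top)"
proof -
  define \<mu> where "\<mu> = - 2 * a"
  have \<mu>: "\<mu> > 0" using ab by (simp add: \<mu>_def)
  have \<beta>: "-1 \<le> b / - a" "b / - a < 1" using ab by (auto simp: field_simps)
  obtain q where q: "0 \<le> q" "q < 1"
    "\<And>t. ((\<lambda>u. \<bar>resolvent_kernel \<alpha> \<mu> u / 2 + (b / - a) / 2 * resolvent_kernel \<alpha> \<mu> (u - \<tau>)\<bar>) \<star> (\<lambda>_. 1)) t \<le> q"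
    using delayed_resolvent_norm_less_1[OF \<alpha> \<mu> \<tau> \<beta>] by blast
  \<comment> \<open>Half of the available margin:
    \<open>q + \<eta> / \<mu> = (1 + q) / 2 < 1\<close>.\<close>
  define \<eta> where "\<eta> = \<mu> * (1 - q) / 2"
  have \<eta>: "\<eta> > 0" using \<mu> q by (simp add: \<eta>_def)
  obtain \<rho> where \<rho>: "\<rho> > 0"
    and f_lip: "\<And>x y x' y'. \<bar>x\<bar> \<le> \<rho> \<Longrightarrow> \<bar>y\<bar> \<le> \<rho> \<Longrightarrow> \<bar>x'\<bar> \<le> \<rho> \<Longrightarrow> \<bar>y'\<bar> \<le> \<rho> \<Longrightarrow>
      \<bar>f x y - f x' y'\<bar> \<le> \<eta> * max \<bar>x - x'\<bar> \<bar>y - y'\<bar>"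
    using lip_const_small[OF lip lim \<eta>] by metis
  \<comment> \<open>Clamping is 1-Lipschitz and the identity on \<open>[-\<rho>, \<rho>]\<close>, so
    \<open>g\<close> keeps the constant \<open>\<eta>\<close> globally and agrees with
    \<open>f\<close> on the square.\<close>
  define cut where "cut = (\<lambda>u. max (-\<rho>) (min \<rho> u))"
  define g where "g = (\<lambda>u v. f (cut u) (cut v))"
  have cut_bd: "\<bar>cut u\<bar> \<le> \<rho>" for u using \<rho> by (auto simp: cut_def)
  have cut_lip: "\<bar>cut u - cut v\<bar> \<le> \<bar>u - v\<bar>" for u v by (auto simp: cut_def min_def max_def)
  have cut_id: "\<bar>u\<bar> \<le> \<rho> \<Longrightarrow> cut u = u" for u by (auto simp: cut_def)
  have g_lip: "\<bar>g u v - g u' v'\<bar> \<le> \<eta> * max \<bar>u - u'\<bar> \<bar>v - v'\<bar>" for u v u' v'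
  proof -
    have "\<bar>g u v - g u' v'\<bar> \<le> \<eta> * max \<bar>cut u - cut u'\<bar> \<bar>cut v - cut v'\<bar>"
      unfolding g_def by (intro f_lip cut_bd)
    also have "\<dots> \<le> \<eta> * max \<bar>u - u'\<bar> \<bar>v - v'\<bar>"
      using \<eta> by (intro mult_left_mono max.mono cut_lip) auto
    finally show ?thesis .
  qed
  interpret D: delay_equation \<alpha> \<tau> a b \<eta> q g
  proof
    show "g 0 0 = 0" using \<rho> by (simp add: g_def cut_id f0)
    show "q + \<eta> / (- 2 * a) < 1"
      unfolding \<mu>_def[symmetric] using \<mu> q(1,2) by (simp add: \<eta>_def field_simps)
  qed (use \<alpha> \<tau> ab g_lip q \<eta> in \<open>auto simp: \<mu>_def\<close>)
  \<comment> \<open>\<open>\<delta>\<close> is tuned so that the bound of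
    \<open>a_priori_bound\<close> is exactly \<open>M\<close>. That \<open>M\<close> lies strictly
    below \<open>\<rho>\<close> is what the first-exit argument contradicts.\<close>
  define M where "M = min \<rho> \<epsilon> / 2"
  define \<delta> where "\<delta> = M * (1 - D.rate) / 3"
  have M: "0 < M" "M < \<rho>" "M < \<epsilon>" using \<rho> \<epsilon> by (auto simp: M_def)
  have \<delta>: "\<delta> > 0" "3 * \<delta> / (1 - D.rate) = M" using M D.rate by (auto simp: \<delta>_def)
  have \<delta>M: "\<delta> < \<rho>"
  proof -
    have "M * (1 - D.rate) \<le> M * 1" using D.rate M by (intro mult_left_mono) auto
    then show ?thesis unfolding \<delta>_def using M by linarith
  qed
  \<comment> \<open>Smallness is required from \<open>-\<tau>\<close> on, since the delayed argument
    of \<open>f\<close> also has to escape the truncation.\<close>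
  have equation_iff: "(\<forall>t\<in>{0..T}. caputo_prim \<alpha> x t =
            integral {0..t} (\<lambda>s. a * x s + b * x (s - \<tau>) + f (x s) (x (s - \<tau>)))) \<longleftrightarrow>
         (\<forall>t\<in>{0..T}. x t = D.voc (x 0) x t)"
    if x: "continuous_on {-\<tau>..} x" and T: "T > 0" and small: "\<And>s. -\<tau> \<le> s \<Longrightarrow> s \<le> T \<Longrightarrow> \<bar>x s\<bar> \<le> \<rho>" for x T
  proof -
    have "integral {0..t} (\<lambda>s. a * x s + b * x (s - \<tau>) + f (x s) (x (s - \<tau>))) =
        integral {0..t} (\<lambda>s. a * x s + b * x (s - \<tau>) + g (x s) (x (s - \<tau>)))" if "t \<in> {0..T}" for t
      using that \<tau> by (intro Henstock_Kurzweil_Integration.integral_cong) (auto simp: g_def cut_id small)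
    then show ?thesis using D.caputo_iff_voc[OF x T] by simp
  qed
  show ?thesis
  proof (intro exI[of _ \<delta>] conjI allI impI)
    show "\<delta> > 0" by (rule \<delta>)
    fix \<phi> assume "small_init \<tau> \<delta> \<phi>"
    then have \<phi>: "continuous_on {-\<tau>..0} \<phi>" "\<And>t. -\<tau> \<le> t \<Longrightarrow> t \<le> 0 \<Longrightarrow> \<bar>\<phi> t\<bar> \<le> \<delta>"
      by (auto simp: small_init_def)
    show "\<exists>x. is_global_solution \<alpha> \<tau> a b f \<phi> x"
    proof -
      obtain x where x: "continuous_on UNIV x" "\<And>t. -\<tau> \<le> t \<Longrightarrow> t \<le> 0 \<Longrightarrow> x t = \<phi> t"
        "\<And>t. 0 \<le> t \<Longrightarrow> x t = D.voc (x 0) x t"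
        using D.voc_fixed_point[OF \<phi>(1)] by blast
      have xc: "continuous_on {-\<tau>..} x" by (rule continuous_on_subset[OF x(1)]) auto
      have x_le: "\<bar>x t\<bar> \<le> M" if "0 \<le> t" for t
        unfolding \<delta>(2)[symmetric]
      proof (rule D.a_priori_bound[OF xc])
        show "\<bar>x s\<bar> \<le> \<delta>" if "-\<tau> \<le> s" "s \<le> 0" for s using \<phi>(2) x(2) that by simp
        show "x s = D.voc (x 0) x s" if "0 \<le> s" for s using that by (rule x(3))
      qed (use that in auto)
      have small: "\<bar>x t\<bar> \<le> \<rho>" if "-\<tau> \<le> t" for t
        using that M(2) \<delta>M x(2)[of t] \<phi>(2)[of t] x_le[of t] by (cases "t \<le> 0") auto
      have "is_solution \<alpha> \<tau> a b f \<phi> T x" if T: "T > 0" for T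
        unfolding is_solution_def
      proof (intro conjI ballI)
        show "continuous_on {-\<tau>..<T} x" by (rule continuous_on_subset[OF x(1)]) auto
        show "x t = \<phi> t" if "t \<in> {-\<tau>..0}" for t using x(2) that by auto
        show "caputo_prim \<alpha> x t = integral {0..t} (\<lambda>s. a * x s + b * x (s - \<tau>) + f (x s) (x (s - \<tau>)))"
          if "t \<in> {0..<T}" for t
        proof -
          have "\<forall>t\<in>{0..T}. x t = D.voc (x 0) x t" using x(3) by (meson atLeastAtMost_iff)
          then have "\<forall>t\<in>{0..T}. caputo_prim \<alpha> x t =
              integral {0..t} (\<lambda>s. a * x s + b * x (s - \<tau>) + f (x s) (x (s - \<tau>)))"
            using equation_iff[OF xc T] small by blast
          then show ?thesis by (rule bspec) (use that in auto)
        qed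
      qed
      then show ?thesis unfolding is_global_solution_def by blast
    qed
    fix x assume sol: "is_global_solution \<alpha> \<tau> a b f \<phi> x"
    have init: "x t = \<phi> t" if "-\<tau> \<le> t" "t \<le> 0" for t
      using sol that unfolding is_global_solution_def is_solution_def by (metis atLeastAtMost_iff zero_less_one)
    have xc: "continuous_on {-\<tau>..} x"
      unfolding continuous_on_eq_continuous_within
    proof
      fix t assume t: "t \<in> {-\<tau>..}"
      define T where "T = max t 0 + 1"
      have "continuous_on {-\<tau>..<T} x"
        using sol unfolding is_global_solution_def is_solution_def by (simp add: T_def)
      moreover have "t \<in> {-\<tau>..<T}" using t by (simp add: T_def)
      ultimately have "continuous (at t within {-\<tau>..<T}) x"
        by (simp add: continuous_on_eq_continuous_within)
      moreover have "at t within {-\<tau>..<T} = at t within {-\<tau>..}"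
        by (rule at_within_nhd[of t "{..<T}"]) (auto simp: T_def)
      ultimately show "continuous (at t within {-\<tau>..}) x" by simp
    qed
    have caputo: "\<forall>t\<in>{0..T}. caputo_prim \<alpha> x t = integral {0..t} (\<lambda>s. a * x s + b * x (s - \<tau>) + f (x s) (x (s - \<tau>)))" for T
    proof
      fix t assume "t \<in> {0..T}"
      then show "caputo_prim \<alpha> x t = integral {0..t} (\<lambda>s. a * x s + b * x (s - \<tau>) + f (x s) (x (s - \<tau>)))"
        using sol[unfolded is_global_solution_def, rule_format, of "t + 1"] by (simp add: is_solution_def)
    qed
    have init_le: "\<bar>x t\<bar> \<le> \<delta>" if "-\<tau> \<le> t" "t \<le> 0" for t using init \<phi>(2) that by simp
    have bound: "\<bar>x t\<bar> \<le> M" if small: "\<And>s. -\<tau> \<le> s \<Longrightarrow> s \<le> T \<Longrightarrow> \<bar>x s\<bar> \<le> \<rho>" and "T > 0" "0 \<le> t" "t \<le> T" for t T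
    proof -
      have "\<forall>t\<in>{0..T}. x t = D.voc (x 0) x t"
        using equation_iff[OF xc \<open>T > 0\<close> small] caputo[of T] by blast
      then have "x s = D.voc (x 0) x s" if "0 \<le> s" "s \<le> T" for s using that by (meson atLeastAtMost_iff)
      from D.a_priori_bound[OF xc init_le this that(3,4)] show ?thesis by (simp add: \<delta>(2))
    qed
    have inside: "\<bar>x t\<bar> < \<rho>" if "t \<ge> 0" for t
    proof (rule ccontr)
      assume "\<not> \<bar>x t\<bar> < \<rho>"
      \<comment> \<open>The least element \<open>z\<close> of \<open>Z\<close> is the first time at
        which \<open>\<bar>x\<bar>\<close> reaches \<open>\<rho>\<close>. Up to \<open>z\<close> the
        truncated equation holds, so the a priori bound gives
        \<open>\<bar>x z\<bar> \<le> M < \<rho>\<close>.\<close>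
      define Z where "Z = {0..t} \<inter> (\<lambda>s. \<bar>x s\<bar>) -` {\<rho>..}"
      have "closed Z"
        unfolding Z_def using \<tau>
        by (intro continuous_closed_preimage continuous_intros continuous_on_subset[OF xc]) auto
      moreover have "bounded Z" unfolding Z_def by (rule bounded_subset[of "{0..t}"]) auto
      ultimately have "compact Z" by (simp add: compact_eq_bounded_closed)
      moreover have "t \<in> Z" using \<open>\<not> \<bar>x t\<bar> < \<rho>\<close> that by (simp add: Z_def)
      ultimately obtain z where z: "z \<in> Z" "\<And>s. s \<in> Z \<Longrightarrow> z \<le> s"
        using compact_attains_inf[of Z] by blast
      have z_ge: "\<bar>x z\<bar> \<ge> \<rho>" and "0 \<le> z" "z \<le> t" using z(1) by (auto simp: Z_def)
      moreover have "z \<noteq> 0" using init_le[of 0] z_ge \<delta>M \<tau> by auto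
      ultimately have z_pos: "z > 0" by simp
      have before: "\<bar>x s\<bar> < \<rho>" if "-\<tau> \<le> s" "s < z" for s
      proof (cases "s \<le> 0")
        case False
        then show ?thesis using z(2)[of s] that \<open>z \<le> t\<close> by (force simp: Z_def)
      qed (use init_le[of s] that \<delta>M in auto)
      \<comment> \<open>\<open>bound\<close> needs smallness on the closed interval; the endpoint is
        reached by continuity from the left.\<close>
      have "\<bar>x z\<bar> \<le> \<rho>"
      proof (rule tendsto_upperbound[of "\<lambda>s. \<bar>x s\<bar>" _ "at_left z"])
        have "(x \<longlongrightarrow> x z) (at z)"
          using continuous_on_interior[OF xc, of z] z_pos \<tau> by (simp add: isCont_def)
        then show "((\<lambda>s. \<bar>x s\<bar>) \<longlongrightarrow> \<bar>x z\<bar>) (at_left z)"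
          by (rule tendsto_rabs[OF tendsto_within_subset[OF _ subset_UNIV]])
        show "eventually (\<lambda>s. \<bar>x s\<bar> \<le> \<rho>) (at_left z)"
          using eventually_at_left_real[OF z_pos] by eventually_elim (use before \<tau> in \<open>auto intro: less_imp_le\<close>)
      qed simp
      then have "\<bar>x s\<bar> \<le> \<rho>" if "-\<tau> \<le> s" "s \<le> z" for s
        using before[of s] that by (cases "s = z") auto
      then have "\<bar>x z\<bar> \<le> M" using bound[of z z] z_pos by simp
      then show False using z_ge M(2) by linarith
    qed
    have small: "\<bar>x t\<bar> \<le> \<rho>" if "-\<tau> \<le> t" for t
      using inside[of t] init_le[of t] \<delta>M that by (cases "t \<le> 0") auto
    have "\<bar>x t\<bar> \<le> M" if "t \<ge> 0" for t
      using bound[of "t + 1" t] small that by simp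
    then show "\<bar>x t\<bar> \<le> \<epsilon>" if "t \<ge> 0" for t using that M(3) by (meson less_imp_le order_trans)
    show "(x \<longlongrightarrow> 0) at_top"
    proof (rule D.solution_tendsto_0[OF xc small])
      fix t :: real assume t: "0 \<le> t"
      have "\<forall>s\<in>{0..t + 1}. x s = D.voc (x 0) x s"
        using equation_iff[OF xc, of "t + 1"] small caputo[of "t + 1"] t by fastforce
      then show "x t = D.voc (x 0) x t" by (rule bspec) (use t in auto)
    qed
  qed
qed

theorem theorem5p1:
  fixes \<alpha> \<tau> a b :: real and f :: "real \<Rightarrow> real \<Rightarrow> real"
  assumes "0 < \<alpha>" "\<alpha> < 1" "0 < \<tau>" "a \<le> b" "b < - a"
    and "loc_lipschitz2 f"
    and "f 0 0 = 0"
    and "(lip_const f \<longlongrightarrow> 0) (at_right 0)"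
  shows "trivial_asymp_stable \<alpha> \<tau> a b f"
  unfolding trivial_asymp_stable_def
proof
  note small = small_initial_data[OF assms]
  show "trivial_stable \<alpha> \<tau> a b f"
    unfolding trivial_stable_def
  proof (intro allI impI)
    fix \<epsilon> :: real assume "\<epsilon> > 0"
    from small[OF this] show "\<exists>\<delta>>0. \<forall>\<phi>. small_init \<tau> \<delta> \<phi> \<longrightarrow>
        (\<exists>x. is_global_solution \<alpha> \<tau> a b f \<phi> x) \<and>
        (\<forall>x. is_global_solution \<alpha> \<tau> a b f \<phi> x \<longrightarrow> (\<forall>t\<ge>0. \<bar>x t\<bar> \<le> \<epsilon>))"
      by (elim ex_forward conj_forward all_forward imp_forward) auto
  qed
  \<comment> \<open>The choice \<open>\<epsilon> = 1\<close> is arbitrary: convergence to 0 is part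
    of the conclusion for every \<open>\<epsilon>\<close>.\<close>
  from small[OF zero_less_one] show "trivial_attractive \<alpha> \<tau> a b f"
    unfolding trivial_attractive_def
    by (elim ex_forward conj_forward all_forward imp_forward) auto
qed

end
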